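(* Let $f$ be a twist map of the annulus, let $c\in\mathbb{R}$, and let $u_c:\mathbb{R}\to\mathbb{R}$ be a discrete weak K.A.M. solution for $f$ at cohomology class $c$. (1) If $\operatorname{Sing}(u_c)/\mathbb{Z}$ is not empty and has finitely many elements, then $\alpha'(c)\in\mathbb{Q}$. (2) If $\alpha'(c)\in\mathbb{R}\setminus\mathbb{Q}$, then $\operatorname{Sing}(u_c)/\mathbb{Z}$ is either empty or countably infinite.
   Context: Let $\mathbb{T}=\mathbb{R}/\mathbb{Z}$. A twist map of the annulus is a $C^1$-diffeomorphism $f:\mathbb{T}\times\mathbb{R}\to\mathbb{T}\times\mathbb{R}$ such that: (1) $f$ is isotopic to the identity; (2) $f$ is exact symplectic, i.e. if $f(\theta,p)=(\theta',p')$ then the $1$-form $p'd\theta'-p\,d\theta$ is exact; (3) if $F:\mathbb{R}^2\to\mathbb{R}^2$, $F(x,p)=(y,p')$, is a lift of $f$, there is $\varepsilon>0$ with $0<\frac{\partial y}{\partial p}(x,p)<\frac1\varepsilon$ for all $(x,p)$. Fix a lift $F$ of $f$. Its generating function is a $C^2$ function $S:\mathbb{R}^2\to\mathbb{R}$ (which exists and is unique up to an additive constant) such that $S(x+1,y+1)=S(x,y)$; there is $\varepsilon>0$ with $\frac{\partial^2S}{\partial x\partial y}<-\varepsilon$ everywhere; and $F(x,p)=(y,p')$ if and only if $p=-\partial_1S(x,y)$ and $p'=\partial_2S(x,y)$. For $c\in\mathbb{R}$ put $S_c(x,y)=S(x,y)+c(x-y)$. For a bounded $1$-periodic function $u:\mathbb{R}\to\mathbb{R}$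 put $T^-[u](x)=\inf_{y\in\mathbb{R}}\{u(y)+S_c(y,x)\}$. There is a unique constant $\overline{S}_c\in\mathbb{R}$ for which $u=T^-[u]-\overline{S}_c$ has a continuous $1$-periodic solution $u$; any such solution is called a discrete weak K.A.M. solution for $f$ at cohomology class $c$. Mather's function is $\alpha(c)=-\overline{S}_c$; it is differentiable at every $c\in\mathbb{R}$. $\operatorname{Sing}(u_c)$ is the set of points of $\mathbb{R}$ at which $u_c$ is not differentiable; it is invariant under integer translations, and $\operatorname{Sing}(u_c)/\mathbb{Z}$ is its image in $\mathbb{T}$. *)

theory Defs
  imports "HOL-Analysis.Analysis"
begin

definition C1_map :: "('a::real_normed_vector \<Rightarrow> 'b::real_normed_vector) \<Rightarrow> bool" where
  "C1_map g \<longleftrightarrow>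
     (\<exists>g' :: 'a \<Rightarrow> 'a \<Rightarrow>\<^sub>L 'b.
        (\<forall>z. (g has_derivative blinfun_apply (g' z)) (at z)) \<and> continuous_on UNIV g')"

definition C2_map :: "('a::real_normed_vector \<Rightarrow> 'b::real_normed_vector) \<Rightarrow> bool" where
  "C2_map g \<longleftrightarrow>
     (\<exists>g' :: 'a \<Rightarrow> 'a \<Rightarrow>\<^sub>L 'b.
        (\<forall>z. (g has_derivative blinfun_apply (g' z)) (at z)) \<and> C1_map g')"

definition partial1 :: "(real \<times> real \<Rightarrow> real) \<Rightarrow> real \<times> real \<Rightarrow> real" where
  "partial1 g z = deriv (\<lambda>t. g (t, snd z)) (fst z)"

definition partial2 :: "(real \<times> real \<Rightarrow> real) \<Rightarrow> real \<times> real \<Rightarrow> real" where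
  "partial2 g z = deriv (\<lambda>t. g (fst z, t)) (snd z)"

text \<open>The circle \<open>\<real>/\<int>\<close> is modelled as the unit circle in the complex plane, the class of \<open>x\<close>
  being \<open>exp (2 \<pi> \<i> x)\<close>. Maps of the annulus are functions on \<open>complex \<times> real\<close> whose values
  outside \<open>annulus\<close> are irrelevant.\<close>

definition to_circle :: "real \<Rightarrow> complex" where
  "to_circle x = cis (2 * pi * x)"

definition annulus :: "(complex \<times> real) set" where
  "annulus = sphere 0 1 \<times> UNIV"

definition annulus_cover :: "real \<times> real \<Rightarrow> complex \<times> real" where
  "annulus_cover z = (to_circle (fst z), snd z)"

text \<open>Since \<open>annulus_cover\<close> is a local diffeomorphism onto the embedded surface \<open>annulus\<close>, a self-map
  of the annulus is \<open>C\<^sup>1\<close> iff its composition with \<open>annulus_cover\<close> is \<open>C\<^sup>1\<close> into \<open>complex \<times> real\<close>.\<close>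

definition annulus_C1_diffeo :: "(complex \<times> real \<Rightarrow> complex \<times> real) \<Rightarrow> bool" where
  "annulus_C1_diffeo f \<longleftrightarrow>
     bij_betw f annulus annulus \<and>
     C1_map (f \<circ> annulus_cover) \<and> C1_map (the_inv_into annulus f \<circ> annulus_cover)"

definition annulus_isotopic_id :: "(complex \<times> real \<Rightarrow> complex \<times> real) \<Rightarrow> bool" where
  "annulus_isotopic_id f \<longleftrightarrow>
     homotopic_with (\<lambda>h. homeomorphic_map (top_of_set annulus) (top_of_set annulus) h)
       (top_of_set annulus) (top_of_set annulus) id f"

definition is_lift ::
    "(real \<times> real \<Rightarrow> real \<times> real) \<Rightarrow> (complex \<times> real \<Rightarrow> complex \<times> real) \<Rightarrow> bool" where
  "is_lift F f \<longleftrightarrow>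
     continuous_on UNIV F \<and> (\<forall>z. annulus_cover (F z) = f (annulus_cover z))"

text \<open>For a lift \<open>F (x, p) = (y, p')\<close> of \<open>f\<close>, the form \<open>p' d\<theta>' - p d\<theta>\<close> on the annulus pulls back to
  \<open>p' dy - p dx\<close>. It is exact when it is the differential of a function \<open>h\<close> on the annulus; such
  an \<open>h\<close> is automatically \<open>C\<^sup>1\<close> when \<open>f\<close> is.\<close>

definition exact_symplectic_lift :: "(real \<times> real \<Rightarrow> real \<times> real) \<Rightarrow> bool" where
  "exact_symplectic_lift F \<longleftrightarrow>
     (\<exists>h :: complex \<times> real \<Rightarrow> real. \<forall>z.
        ((h \<circ> annulus_cover) has_derivative
           (\<lambda>v. snd (F z) * fst (frechet_derivative F (at z) v) - snd z * fst v)) (at z))"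

text \<open>Two lifts differ by an integer translation in the first coordinate, so the last two conditions
  do not depend on the lift.\<close>

definition twist_map :: "(complex \<times> real \<Rightarrow> complex \<times> real) \<Rightarrow> bool" where
  "twist_map f \<longleftrightarrow>
     annulus_C1_diffeo f \<and> annulus_isotopic_id f \<and>
     (\<forall>F. is_lift F f \<longrightarrow> exact_symplectic_lift F) \<and>
     (\<forall>F. is_lift F f \<longrightarrow>
        (\<exists>\<epsilon>>0. \<forall>z. 0 < partial2 (\<lambda>w. fst (F w)) z \<and> partial2 (\<lambda>w. fst (F w)) z < 1 / \<epsilon>))"

definition generating_function ::
    "(real \<times> real \<Rightarrow> real \<times> real) \<Rightarrow> (real \<times> real \<Rightarrow> real) \<Rightarrow> bool" where
  "generating_function F S \<longleftrightarrow>
     C2_map S \<and>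
     (\<forall>x y. S (x + 1, y + 1) = S (x, y)) \<and>
     (\<exists>\<epsilon>>0. \<forall>z. partial1 (partial2 S) z < - \<epsilon>) \<and>
     (\<forall>x p y p'. F (x, p) = (y, p') \<longleftrightarrow> p = - partial1 S (x, y) \<and> p' = partial2 S (x, y))"

definition S_coh :: "(real \<times> real \<Rightarrow> real) \<Rightarrow> real \<Rightarrow> real \<times> real \<Rightarrow> real" where
  "S_coh S c z = S z + c * (fst z - snd z)"

definition Tminus :: "(real \<times> real \<Rightarrow> real) \<Rightarrow> real \<Rightarrow> (real \<Rightarrow> real) \<Rightarrow> real \<Rightarrow> real" where
  "Tminus S c u x = (INF y. u y + S_coh S c (y, x))"

definition weak_KAM_with_constant ::
    "(real \<times> real \<Rightarrow> real) \<Rightarrow> real \<Rightarrow> real \<Rightarrow> (real \<Rightarrow> real) \<Rightarrow> bool" where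
  "weak_KAM_with_constant S c s u \<longleftrightarrow>
     continuous_on UNIV u \<and> (\<forall>x. u (x + 1) = u x) \<and> (\<forall>x. u x = Tminus S c u x - s)"

definition S_bar :: "(real \<times> real \<Rightarrow> real) \<Rightarrow> real \<Rightarrow> real" where
  "S_bar S c = (THE s. \<exists>u. weak_KAM_with_constant S c s u)"

definition weak_KAM_solution :: "(real \<times> real \<Rightarrow> real) \<Rightarrow> real \<Rightarrow> (real \<Rightarrow> real) \<Rightarrow> bool" where
  "weak_KAM_solution S c u \<longleftrightarrow> weak_KAM_with_constant S c (S_bar S c) u"

definition mather_alpha :: "(real \<times> real \<Rightarrow> real) \<Rightarrow> real \<Rightarrow> real" where
  "mather_alpha S c = - S_bar S c"

definition Sing :: "(real \<Rightarrow> real) \<Rightarrow> real set" where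
  "Sing u = {x. \<not> u differentiable (at x)}"

definition Sing_mod :: "(real \<Rightarrow> real) \<Rightarrow> complex set" where
  "Sing_mod u = to_circle ` Sing u"

end

theory Submission
  imports Defs
begin

text \<open>
  A pair \<open>(x, y)\<close> is called calibrated when \<open>x\<close> realises the infimum in \<open>u(y) = T\<^sup>-[u](y) - s\<close>;
  then \<open>x\<close> is a source of \<open>y\<close>. Coercivity of \<open>S\<close> provides every \<open>y\<close> with a source. The twist
  condition makes sources strictly increasing in \<open>y\<close> (calibrated_strict_mono). The function \<open>u\<close> is
  differentiable at every source (calibrated_not_Sing) and not differentiable at a point with
  several sources (two_calibrated_imp_Sing).

  Countability: if a monotone choice of sources is continuous at \<open>y\<close>, then \<open>u\<close> is differentiable
  at \<open>y\<close>, and a monotone function has countably many discontinuities.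

  Rationality: the intervals spanned by the sources of the various \<open>y\<close> tile the line, and mapping
  each of them to its \<open>y\<close> defines a continuous nondecreasing map \<open>forward\<close> that commutes with
  integer translations. A singular point \<open>x\<close> is not a source, so it is interior to the interval of
  \<open>forward x\<close>, which therefore has two sources and is singular again. Thus \<open>forward\<close> maps the
  singular set into itself. If that set is nonempty and finite modulo \<open>\<int>\<close>, some point satisfies
  \<open>forward\<^sup>q x = x + p\<close> with \<open>q > 0\<close>, and \<open>forward\<close> has rotation number \<open>p / q\<close>.

  It remains to see that Mather's function is differentiable at \<open>c\<close> with derivative \<open>p / q\<close>.
  Summing the defect of a solution at one class along an orbit calibrated at another class gives
  \<open>\<rho>\<^sub>c (c' - c) \<le> \<alpha>(c') - \<alpha>(c) \<le> \<rho>\<^sub>c\<^sub>' (c' - c)\<close>, where \<open>\<rho>\<^sub>c\<close> and \<open>\<rho>\<^sub>c\<^sub>'\<close> stand for the mean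
  displacements of the orbits calibrated at \<open>c\<close> and \<open>c'\<close>. So \<open>\<rho>\<^sub>c\<^sub>'\<close> must be shown to be close to
  \<open>\<rho>\<^sub>c = p / q\<close>. The average \<open>\<psi>\<close> of many iterates of \<open>forward\<close> increases by almost exactly \<open>p / q\<close>
  along pairs calibrated at \<open>c\<close>. By compactness \<open>\<bar>\<psi>(y) - \<psi>(x) - p / q\<bar> \<le> \<epsilon> + C d(x, y)\<close> for all
  pairs with a bounded step, where \<open>d\<close> is the defect at \<open>c\<close> (approximate_conjugacy). Along an
  orbit calibrated at \<open>c'\<close> the mean of \<open>d\<close> is at most proportional to \<open>\<bar>c' - c\<bar>\<close>, which gives the
  claim (constant_expansion).

  The value of Mather's function at the classes \<open>c'\<close> near \<open>c\<close> has a meaning only once solutions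
  exist there and determine their constant; this is weak_KAM_exists and constant_unique.
\<close>

section \<open>One-dimensional calculus and compactness\<close>

text \<open>The usual substitute for semiconcavity: a function squeezed at \<open>x\<close> between two
  differentiable ones is differentiable there. Points of calibrated orbits are in this situation.\<close>

lemma touching_imp_derivative:
  fixes u f h :: "real \<Rightarrow> real"
  assumes f: "(f has_real_derivative a) (at x)" and h: "(h has_real_derivative b) (at x)"
    and below: "\<And>t. f t \<le> u t" and above: "\<And>t. u t \<le> h t"
    and eq: "f x = u x" "h x = u x"
  shows "a = b" "(u has_real_derivative a) (at x)"
proof -
  have "((\<lambda>t. h t - f t) has_real_derivative (b - a)) (at x)"
    using f h by (intro derivative_intros)
  moreover have "\<forall>t. \<bar>x - t\<bar> < 1 \<longrightarrow> h x - f x \<le> h t - f t"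
    using below above eq by (smt (verit))
  ultimately have "b - a = 0"
    using DERIV_local_min[of "\<lambda>t. h t - f t" "b - a" x 1] by simp
  then show ab: "a = b" by simp
  have qf: "((\<lambda>t. (f t - f x) / (t - x)) \<longlongrightarrow> a) (at x)"
    using f by (simp add: has_field_derivative_iff)
  have qh: "((\<lambda>t. (h t - h x) / (t - x)) \<longlongrightarrow> a) (at x)"
    using h ab by (simp add: has_field_derivative_iff)
  have lim: "((\<lambda>t. \<bar>(f t - f x) / (t - x) - a\<bar> + \<bar>(h t - h x) / (t - x) - a\<bar>) \<longlongrightarrow> \<bar>a - a\<bar> + \<bar>a - a\<bar>) (at x)"
    by (intro tendsto_intros qf qh)
  have "((\<lambda>t. (u t - u x) / (t - x) - a) \<longlongrightarrow> 0) (at x)"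
  proof (rule Lim_null_comparison[where g = "\<lambda>t. \<bar>(f t - f x) / (t - x) - a\<bar> + \<bar>(h t - h x) / (t - x) - a\<bar>"])
    show "\<forall>\<^sub>F t in at x. norm ((u t - u x) / (t - x) - a)
        \<le> \<bar>(f t - f x) / (t - x) - a\<bar> + \<bar>(h t - h x) / (t - x) - a\<bar>"
    proof (rule always_eventually, rule allI)
      fix t
      have *: "f t - f x \<le> u t - u x" "u t - u x \<le> h t - h x"
        using below[of t] above[of t] eq by auto
      show "norm ((u t - u x) / (t - x) - a)
        \<le> \<bar>(f t - f x) / (t - x) - a\<bar> + \<bar>(h t - h x) / (t - x) - a\<bar>"
      proof (cases "t \<ge> x")
        case True
        then have "(f t - f x) / (t - x) \<le> (u t - u x) / (t - x)"
          "(u t - u x) / (t - x) \<le> (h t - h x) / (t - x)"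
          using * by (auto intro: divide_right_mono)
        then show ?thesis by (simp add: abs_if)
      next
        case False
        then have "(h t - h x) / (t - x) \<le> (u t - u x) / (t - x)"
          "(u t - u x) / (t - x) \<le> (f t - f x) / (t - x)"
          using * by (auto intro: divide_right_mono_neg)
        then show ?thesis by (simp add: abs_if)
      qed
    qed
    show "((\<lambda>t. \<bar>(f t - f x) / (t - x) - a\<bar> + \<bar>(h t - h x) / (t - x) - a\<bar>) \<longlongrightarrow> 0) (at x)"
      using lim by simp
  qed
  then show "(u has_real_derivative a) (at x)"
    unfolding has_field_derivative_iff using LIM_zero_iff by blast
qed

lemma touching_above_derivative:
  fixes u h :: "real \<Rightarrow> real"
  assumes u: "(u has_real_derivative a) (at x)" and h: "(h has_real_derivative b) (at x)"
    and above: "\<And>t. u t \<le> h t" and eq: "h x = u x"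
  shows "a = b"
  using touching_imp_derivative(1)[OF u h _ above _ eq] by simp

text \<open>Where \<open>h\<close> is at least \<open>b + \<epsilon>\<close>, \<open>d\<close> has a positive minimum, so a large multiple of \<open>d\<close> pays
  for the excess of \<open>h\<close> over \<open>b\<close>. A statement known only along exactly calibrated pairs becomes in
  this way an inequality valid for all pairs, which can be summed along arbitrary orbits.\<close>

lemma penalty_bound:
  fixes h d :: "'a::topological_space \<Rightarrow> real"
  assumes Q: "compact Q" and ch: "continuous_on Q h" and cd: "continuous_on Q d"
    and d0: "\<And>z. z \<in> Q \<Longrightarrow> 0 \<le> d z" and dz: "\<And>z. z \<in> Q \<Longrightarrow> d z = 0 \<Longrightarrow> h z \<le> b"
    and eps: "0 < \<epsilon>"
  shows "\<exists>C\<ge>0. \<forall>z\<in>Q. h z \<le> b + \<epsilon> + C * d z"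
proof -
  let ?R = "{z\<in>Q. b + \<epsilon> \<le> h z}"
  have "\<exists>U. closed U \<and> U \<inter> Q = h -` {b + \<epsilon>..} \<inter> Q"
    using ch unfolding continuous_on_closed_invariant by (metis closed_atLeast)
  then obtain U where "closed U" "U \<inter> Q = ?R" by (auto simp: vimage_def)
  then have R: "compact ?R" using Q by (metis compact_Int_closed inf_commute)
  show ?thesis
  proof (cases "?R = {}")
    case True
    then show ?thesis by (intro exI[of _ 0]) (auto simp: not_le less_imp_le)
  next
    case False
    obtain z0 where z0: "z0 \<in> ?R" "\<And>z. z \<in> ?R \<Longrightarrow> d z0 \<le> d z"
      using continuous_attains_inf[OF R False continuous_on_subset[OF cd]] by auto
    obtain z1 where z1: "\<And>z. z \<in> ?R \<Longrightarrow> h z \<le> h z1"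
      using continuous_attains_sup[OF R False continuous_on_subset[OF ch]] by auto
    have pos: "d z0 > 0"
      using z0(1) d0[of z0] dz[of z0] eps by fastforce
    define C where "C = (\<bar>h z1\<bar> + \<bar>b\<bar>) / d z0"
    have C: "C \<ge> 0" using pos by (simp add: C_def)
    have "h z \<le> b + \<epsilon> + C * d z" if "z \<in> Q" for z
    proof (cases "z \<in> ?R")
      case True
      have "C * d z0 \<le> C * d z" using z0(2)[OF True] C by (rule mult_left_mono)
      moreover have "C * d z0 = \<bar>h z1\<bar> + \<bar>b\<bar>" using pos by (simp add: C_def)
      ultimately show ?thesis using z1[OF True] eps by linarith
    next
      case False
      then have "h z \<le> b + \<epsilon>" using that by auto
      moreover have "0 \<le> C * d z" using C d0[OF that] by simp
      ultimately show ?thesis by linarith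
    qed
    then show ?thesis using C by blast
  qed
qed

lemma periodic_int:
  fixes u :: "real \<Rightarrow> 'a"
  assumes "\<And>x. u (x + 1) = u x"
  shows "u (x + of_int n) = u x"
proof (induction n rule: int_induct[where k = 0])
  case (step1 i)
  then show ?case using assms[of "x + of_int i"] by (simp add: add.assoc)
next
  case (step2 i)
  then show ?case using assms[of "x + of_int (i - 1)"] by (simp add: algebra_simps)
qed simp

lemma diagonal_periodic_int:
  fixes h :: "real \<times> real \<Rightarrow> 'a"
  assumes "\<And>x y. h (x + 1, y + 1) = h (x, y)"
  shows "h (x + of_int n, y + of_int n) = h (x, y)"
  using periodic_int[of "\<lambda>t. h (x + t, y + t)" 0 n] assms
  by (simp add: add.assoc[symmetric])

text \<open>Every pair at distance at most \<open>K\<close> is carried into this compact cell by an integer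
  translation along the diagonal.\<close>

definition strip_cell :: "real \<Rightarrow> (real \<times> real) set" where
  "strip_cell K = {0..1} \<times> {-K..K + 1}"

lemma compact_strip_cell: "compact (strip_cell K)"
  unfolding strip_cell_def by (intro compact_Times compact_Icc)

lemma diagonal_periodic_reduce:
  assumes "\<bar>y - x\<bar> \<le> K"
  obtains n where "(x + of_int n, y + of_int n) \<in> strip_cell K"
proof
  show "(x + of_int (- \<lfloor>x\<rfloor>), y + of_int (- \<lfloor>x\<rfloor>)) \<in> strip_cell K"
    using assms unfolding strip_cell_def by (auto; linarith)
qed

lemma diagonal_periodic_bounded:
  fixes h :: "real \<times> real \<Rightarrow> real"
  assumes per: "\<And>x y. h (x + 1, y + 1) = h (x, y)" and cont: "continuous_on UNIV h"
  shows "\<exists>B\<ge>0. \<forall>x y. \<bar>y - x\<bar> \<le> K \<longrightarrow> \<bar>h (x, y)\<bar> \<le> B"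
proof -
  have "bounded (h ` strip_cell K)"
    using compact_continuous_image[OF continuous_on_subset[OF cont subset_UNIV] compact_strip_cell]
    by (rule compact_imp_bounded)
  then obtain B where B: "B > 0" "\<And>z. z \<in> strip_cell K \<Longrightarrow> \<bar>h z\<bar> \<le> B"
    unfolding bounded_pos by auto
  have "\<bar>h (x, y)\<bar> \<le> B" if "\<bar>y - x\<bar> \<le> K" for x y
    using diagonal_periodic_reduce[OF that] B(2) diagonal_periodic_int[of h, OF per] by metis
  then show ?thesis using B(1) by (intro exI[of _ B]) auto
qed

lemma periodic_bounded:
  fixes u :: "real \<Rightarrow> real"
  assumes per: "\<And>x. u (x + 1) = u x" and cont: "continuous_on UNIV u"
  shows "\<exists>B\<ge>0. \<forall>x. \<bar>u x\<bar> \<le> B"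
proof -
  have "\<exists>B\<ge>0. \<forall>x y::real. \<bar>y - x\<bar> \<le> 0 \<longrightarrow> \<bar>u (fst (x, y))\<bar> \<le> B"
    by (rule diagonal_periodic_bounded)
      (auto simp: per intro!: continuous_intros continuous_on_compose2[OF cont])
  then show ?thesis by auto
qed

lemma le_of_nat_mult_le:
  fixes a b c :: real
  assumes "\<And>n::nat. real n * a \<le> b + real n * c"
  shows "a \<le> c"
proof (rule ccontr)
  assume "\<not> a \<le> c"
  then obtain n :: nat where "b < real n * (a - c)"
    using reals_Archimedean3[of "a - c"] by auto
  then show False using assms[of n] by (simp add: algebra_simps)
qed

text \<open>Hyers' theorem for sequences: \<open>a + C\<close> is subadditive and \<open>a - C\<close> superadditive, so that the
  slopes of the second stay below those of the first, and \<open>s\<close> separates the two families.\<close>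

lemma quasi_additive_linear:
  fixes a :: "nat \<Rightarrow> real"
  assumes up: "\<And>m n. \<bar>a (m + n) - a m - a n\<bar> \<le> C"
  shows "\<exists>s. \<forall>n. \<bar>a n - real n * s\<bar> \<le> C"
proof -
  have C: "C \<ge> 0" using up[of 0 0] by linarith
  have sub: "a (n * m) + C \<le> real n * (a m + C)" if "n > 0" for m n
    using that
  proof (induction n rule: nat_induct_non_zero)
    case (Suc n)
    then show ?case using up[of m "n * m"] by (simp add: algebra_simps abs_le_iff)
  qed simp
  \<comment> \<open>The same estimate for \<open>a - C\<close>, with the inequalities reversed.\<close>
  have super: "real n * (a m - C) \<le> a (n * m) - C" if "n > 0" for m n
    using that
  proof (induction n rule: nat_induct_non_zero)
    case (Suc n)
    then show ?case using up[of m "n * m"] by (simp add: algebra_simps abs_le_iff)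
  qed simp
  have cross: "(a m - C) / real m \<le> (a n + C) / real n" if "m > 0" "n > 0" for m n
  proof -
    have "real n * (a m - C) \<le> real m * (a n + C)"
      using super[OF that(2), of m] sub[OF that(1), of n] C by (simp add: mult.commute)
    then show ?thesis using that by (simp add: field_simps)
  qed
  define s where "s = (INF n\<in>{1..}. (a n + C) / real n)"
  have "\<bar>a n - real n * s\<bar> \<le> C" for n
  proof (cases "n = 0")
    case True
    then show ?thesis using up[of 0 0] by simp
  next
    case False
    have "s \<le> (a n + C) / real n" unfolding s_def
    proof (rule cINF_lower)
      show "bdd_below ((\<lambda>n. (a n + C) / real n) ` {1..})"
        using cross[of 1] by (intro bdd_belowI[of _ "(a 1 - C) / real 1"]) auto
    qed (use False in auto)
    moreover have "(a n - C) / real n \<le> s" unfolding s_def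
      using cross[of n] False by (intro cINF_greatest) auto
    ultimately show ?thesis using False by (simp add: field_simps abs_le_iff)
  qed
  then show ?thesis by blast
qed

lemma to_circle_eq_iff: "to_circle x = to_circle y \<longleftrightarrow> (\<exists>k::int. x = y + of_int k)"
proof -
  have "to_circle x = to_circle y \<longleftrightarrow> sin (2 * pi * x) = sin (2 * pi * y) \<and> cos (2 * pi * x) = cos (2 * pi * y)"
    by (auto simp: to_circle_def cis.ctr complex_eq_iff)
  also have "\<dots> \<longleftrightarrow> (\<exists>k::int. 2 * pi * x = 2 * pi * y + 2 * pi * of_int k)"
    by (subst sin_cos_eq_iff) (simp add: mult.commute)
  also have "\<dots> \<longleftrightarrow> (\<exists>k::int. x = y + of_int k)"
    by (simp add: distrib_left[symmetric])
  finally show ?thesis .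
qed

section \<open>Generating functions and minimal steps\<close>

text \<open>What the argument uses of a generating function. \<open>P\<close> is \<open>\<partial>\<^sub>2S\<close>, and the twist condition
  \<open>\<partial>\<^sub>1\<partial>\<^sub>2S < - e\<close> appears integrated once in the first variable.\<close>

locale twist_generating =
  fixes S P :: "real \<times> real \<Rightarrow> real" and e :: real
  assumes S_periodic: "S (x + 1, y + 1) = S (x, y)"
    and S_continuous: "continuous_on UNIV S"
    and S_deriv1: "\<exists>D. ((\<lambda>t. S (t, y)) has_real_derivative D) (at x)"
    and S_deriv2: "((\<lambda>t. S (x, t)) has_real_derivative P (x, y)) (at y)"
    and P_continuous: "continuous_on UNIV P"
    and e_pos: "0 < e"
    and twist: "x \<le> x' \<Longrightarrow> P (x', y) \<le> P (x, y) - e * (x' - x)"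
begin

lemma P_periodic: "P (x + 1, y + 1) = P (x, y)"
proof -
  have "((\<lambda>t. S (x, t)) has_real_derivative P (x + 1, y + 1)) (at y)"
    using S_deriv2[of "x + 1" "y + 1"] DERIV_shift[of "\<lambda>t. S (x + 1, t)" _ y 1]
    by (simp add: S_periodic)
  then show ?thesis using S_deriv2 DERIV_unique by blast
qed

text \<open>The mixed difference of \<open>S\<close> over a rectangle, bounded by integrating the twist condition a
  second time. Uncrossing the segments from \<open>x\<close> to \<open>y'\<close> and from \<open>x'\<close> to \<open>y\<close> lowers the total
  action by at least \<open>e (x' - x) (y' - y)\<close>.\<close>

lemma twist_gap:
  assumes "x \<le> x'" "y \<le> y'"
  shows "S (x', y') - S (x', y) \<le> S (x, y') - S (x, y) - e * (x' - x) * (y' - y)"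
proof -
  define \<phi> where "\<phi> t = S (x, t) - S (x', t) - e * (x' - x) * t" for t
  have "\<phi> y \<le> \<phi> y'"
  proof (rule DERIV_nonneg_imp_nondecreasing[OF assms(2)])
    fix t
    have "(\<phi> has_real_derivative P (x, t) - P (x', t) - e * (x' - x)) (at t)"
      unfolding \<phi>_def by (auto intro!: derivative_eq_intros S_deriv2)
    then show "\<exists>D. (\<phi> has_real_derivative D) (at t) \<and> 0 \<le> D"
      using twist[OF assms(1), of t] by fastforce
  qed
  then show ?thesis unfolding \<phi>_def by (simp add: algebra_simps)
qed

text \<open>Starting on the diagonal, where periodicity bounds \<open>S\<close> and \<open>P\<close>, the twist condition makes
  the derivative of \<open>S (x, y)\<close> in \<open>y\<close>, taken away from the diagonal, grow at rate \<open>e\<close>.\<close>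

lemma S_coercive:
  "\<exists>A\<ge>0. \<exists>B\<ge>0. \<forall>x y. e / 2 * (y - x)\<^sup>2 - A * \<bar>y - x\<bar> - B \<le> S (x, y)"
proof -
  obtain A where A: "A \<ge> 0" "\<And>x y. \<bar>y - x\<bar> \<le> 0 \<Longrightarrow> \<bar>P (x, y)\<bar> \<le> A"
    using diagonal_periodic_bounded[of P, OF P_periodic P_continuous] by blast
  obtain B where B: "B \<ge> 0" "\<And>x y. \<bar>y - x\<bar> \<le> 0 \<Longrightarrow> \<bar>S (x, y)\<bar> \<le> B"
    using diagonal_periodic_bounded[of S, OF S_periodic S_continuous] by blast
  have "e / 2 * (y - x)\<^sup>2 - A * \<bar>y - x\<bar> - B \<le> S (x, y)" for x y
  proof (cases "x \<le> y")
    case True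
    define \<phi> where "\<phi> t = S (x, t) - e / 2 * (t - x)\<^sup>2 + A * (t - x)" for t
    have "\<phi> x \<le> \<phi> y"
    proof (rule DERIV_nonneg_imp_nondecreasing[OF True])
      fix t assume t: "x \<le> t"
      have "(\<phi> has_real_derivative P (x, t) - e * (t - x) + A) (at t)"
        unfolding \<phi>_def by (auto intro!: derivative_eq_intros S_deriv2)
      moreover have "0 \<le> P (x, t) - e * (t - x) + A"
        using twist[OF t, of t] A(2)[of t t] by auto
      ultimately show "\<exists>D. (\<phi> has_real_derivative D) (at t) \<and> 0 \<le> D" by blast
    qed
    then show ?thesis using B(2)[of x x] True by (simp add: \<phi>_def)
  next
    case False
    then have le: "y \<le> x" by simp
    define \<phi> where "\<phi> t = S (x, t) - e / 2 * (t - x)\<^sup>2 - A * (t - x)" for t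
    have "\<phi> x \<le> \<phi> y"
    proof (rule DERIV_nonpos_imp_nonincreasing[OF le])
      fix t assume t: "t \<le> x"
      have "(\<phi> has_real_derivative P (x, t) - e * (t - x) - A) (at t)"
        unfolding \<phi>_def by (auto intro!: derivative_eq_intros S_deriv2)
      moreover have "P (x, t) - e * (t - x) - A \<le> 0"
        using twist[OF t, of t] A(2)[of t t] by (auto simp: algebra_simps)
      ultimately show "\<exists>D. (\<phi> has_real_derivative D) (at t) \<and> D \<le> 0" by blast
    qed
    then show ?thesis using B(2)[of x x] le by (simp add: \<phi>_def algebra_simps)
  qed
  then show ?thesis using A(1) B(1) by blast
qed

lemma S_coh_periodic: "S_coh S c (x + 1, y + 1) = S_coh S c (x, y)"
  by (simp add: S_coh_def S_periodic)

lemma S_coh_continuous: "continuous_on UNIV (S_coh S c)"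
  unfolding S_coh_def[abs_def] by (intro continuous_intros S_continuous)

lemma S_coh_deriv2:
  "((\<lambda>t. S_coh S c (x, t)) has_real_derivative P (x, y) - c) (at y)"
  unfolding S_coh_def by (auto intro!: derivative_eq_intros S_deriv2)

lemma S_coh_mean_value:
  "\<exists>\<xi>. \<bar>\<xi> - y\<bar> \<le> \<bar>t - y\<bar> \<and> S_coh S c (x, t) - S_coh S c (x, y) = (t - y) * (P (x, \<xi>) - c)"
proof -
  consider "y < t" | "t < y" | "t = y" by linarith
  then show ?thesis
  proof cases
    case 1
    obtain \<xi> where "y < \<xi>" "\<xi> < t"
      "S_coh S c (x, t) - S_coh S c (x, y) = (t - y) * (P (x, \<xi>) - c)"
      using MVT2[OF 1, of "\<lambda>t. S_coh S c (x, t)" "\<lambda>\<xi>. P (x, \<xi>) - c"] S_coh_deriv2 by blast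
    then show ?thesis by (intro exI[of _ \<xi>]) auto
  next
    case 2
    obtain \<xi> where "t < \<xi>" "\<xi> < y"
      "S_coh S c (x, y) - S_coh S c (x, t) = (y - t) * (P (x, \<xi>) - c)"
      using MVT2[OF 2, of "\<lambda>t. S_coh S c (x, t)" "\<lambda>\<xi>. P (x, \<xi>) - c"] S_coh_deriv2 by blast
    then show ?thesis by (intro exI[of _ \<xi>]) (auto simp: algebra_simps)
  next
    case 3
    then show ?thesis by auto
  qed
qed

text \<open>An integer translation of the source brings it within distance 1 of the target without
  changing a periodic function of the source. By coercivity this lowers the action of every long
  step, and the threshold is uniform for bounded cohomology classes and independent of the
  periodic function.\<close>

lemma long_step_not_minimal:
  "\<exists>K\<ge>1. \<forall>c x y. \<bar>c\<bar> \<le> R \<longrightarrow> K < \<bar>y - x\<bar> \<longrightarrow>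
     S_coh S c (x + of_int \<lfloor>y - x\<rfloor>, y) < S_coh S c (x, y)"
proof -
  obtain A B where A: "A \<ge> 0" and B: "B \<ge> 0"
    and co: "\<And>x y. e / 2 * (y - x)\<^sup>2 - A * \<bar>y - x\<bar> - B \<le> S (x, y)"
    using S_coercive by blast
  obtain B1 where B1: "B1 \<ge> 0" "\<And>x y. \<bar>y - x\<bar> \<le> 1 \<Longrightarrow> \<bar>S (x, y)\<bar> \<le> B1"
    using diagonal_periodic_bounded[of S, OF S_periodic S_continuous] by blast
  define M where "M = A + B + B1 + 2 * \<bar>R\<bar>"
  define K where "K = max 1 (2 * M / e)"
  have "S_coh S c (x + of_int \<lfloor>y - x\<rfloor>, y) < S_coh S c (x, y)"
    if c: "\<bar>c\<bar> \<le> R" and K: "K < \<bar>y - x\<bar>" for c x y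
  proof -
    define t where "t = \<bar>y - x\<bar>"
    define x' where "x' = x + of_int \<lfloor>y - x\<rfloor>"
    have t: "t > 1" "t > 2 * M / e" using K by (auto simp: K_def t_def)
    have x': "\<bar>y - x'\<bar> \<le> 1" unfolding x'_def by linarith
    have "\<bar>c * (x' - y)\<bar> \<le> \<bar>R\<bar> * 1"
      using c x' unfolding abs_mult by (intro mult_mono) auto
    then have up: "S_coh S c (x', y) \<le> B1 + \<bar>R\<bar>"
      using B1(2)[OF x'] by (simp add: S_coh_def abs_le_iff)
    have "\<bar>c * (x - y)\<bar> \<le> \<bar>R\<bar> * t"
      using c unfolding abs_mult t_def by (intro mult_mono) auto
    then have low: "e / 2 * t\<^sup>2 - A * t - B - \<bar>R\<bar> * t \<le> S_coh S c (x, y)"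
      using co[of y x] by (simp add: S_coh_def t_def abs_le_iff)
    have "M * t < e / 2 * t\<^sup>2"
      using t e_pos by (simp add: power2_eq_square field_simps)
    moreover have "(B + B1 + \<bar>R\<bar>) * 1 \<le> (B + B1 + \<bar>R\<bar>) * t"
      using t(1) B B1(1) by (intro mult_left_mono) auto
    ultimately have "B1 + \<bar>R\<bar> < e / 2 * t\<^sup>2 - A * t - B - \<bar>R\<bar> * t"
      unfolding M_def by (simp add: algebra_simps)
    then show ?thesis using up low unfolding x'_def by linarith
  qed
  then show ?thesis by (intro exI[of _ K]) (auto simp: K_def)
qed

definition step_bound :: "real \<Rightarrow> real" where
  "step_bound R = (SOME K. K \<ge> 1 \<and> (\<forall>c x y. \<bar>c\<bar> \<le> R \<longrightarrow> K < \<bar>y - x\<bar> \<longrightarrow>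
     S_coh S c (x + of_int \<lfloor>y - x\<rfloor>, y) < S_coh S c (x, y)))"

lemma step_bound:
  shows step_bound_ge1: "step_bound R \<ge> 1"
    and long_step: "\<lbrakk>\<bar>c\<bar> \<le> R; step_bound R < \<bar>y - x\<bar>\<rbrakk> \<Longrightarrow>
      S_coh S c (x + of_int \<lfloor>y - x\<rfloor>, y) < S_coh S c (x, y)"
proof -
  have "step_bound R \<ge> 1 \<and> (\<forall>c x y. \<bar>c\<bar> \<le> R \<longrightarrow> step_bound R < \<bar>y - x\<bar> \<longrightarrow>
     S_coh S c (x + of_int \<lfloor>y - x\<rfloor>, y) < S_coh S c (x, y))"
    unfolding step_bound_def using long_step_not_minimal[of R] by (rule someI_ex)
  then show "step_bound R \<ge> 1"
    "\<lbrakk>\<bar>c\<bar> \<le> R; step_bound R < \<bar>y - x\<bar>\<rbrakk> \<Longrightarrow>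
      S_coh S c (x + of_int \<lfloor>y - x\<rfloor>, y) < S_coh S c (x, y)" by blast+
qed

lemma minimal_step_bound:
  assumes "\<And>x. u (x + 1) = u x" and "\<bar>c\<bar> \<le> R"
    and "\<And>z. u x + S_coh S c (x, y) \<le> u z + S_coh S c (z, y)"
  shows "\<bar>y - x\<bar> \<le> step_bound R"
  using long_step[OF assms(2), of y x] assms(3)[of "x + of_int \<lfloor>y - x\<rfloor>"]
    periodic_int[of u x, OF assms(1)] by fastforce

lemma minimizer_exists:
  assumes cont: "continuous_on UNIV u" and per: "\<And>x. u (x + 1) = u x"
  shows "\<exists>x. \<forall>z. u x + S_coh S c (x, y) \<le> u z + S_coh S c (z, y)"
proof -
  let ?K = "step_bound \<bar>c\<bar>"
  have "continuous_on {y - ?K..y + ?K} (\<lambda>z. u z + S_coh S c (z, y))"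
    by (intro continuous_intros continuous_on_subset[OF cont]
        continuous_on_compose2[OF S_coh_continuous]) auto
  moreover have ne: "{y - ?K..y + ?K} \<noteq> {}" using step_bound_ge1[of "\<bar>c\<bar>"] by simp
  ultimately obtain x where x: "\<And>z. z \<in> {y - ?K..y + ?K} \<Longrightarrow>
      u x + S_coh S c (x, y) \<le> u z + S_coh S c (z, y)"
    using continuous_attains_inf[OF compact_Icc] by blast
  have "u x + S_coh S c (x, y) \<le> u z + S_coh S c (z, y)" for z
  proof (cases "\<bar>y - z\<bar> \<le> ?K")
    case True
    then show ?thesis by (intro x) auto
  next
    case False
    define z' where "z' = z + of_int \<lfloor>y - z\<rfloor>"
    have "\<bar>y - z'\<bar> \<le> 1" unfolding z'_def by linarith
    then have "z' \<in> {y - ?K..y + ?K}" using step_bound_ge1[of "\<bar>c\<bar>"] by auto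
    then have "u x + S_coh S c (x, y) \<le> u z' + S_coh S c (z', y)" by (rule x)
    also have "\<dots> = u z + S_coh S c (z', y)"
      unfolding z'_def using periodic_int[of u z, OF per] by simp
    also have "\<dots> < u z + S_coh S c (z, y)"
      using long_step[of c "\<bar>c\<bar>" y z] False unfolding z'_def by simp
    finally show ?thesis by simp
  qed
  then show ?thesis by blast
qed

lemma
  assumes cont: "continuous_on UNIV u" and per: "\<And>x. u (x + 1) = u x"
  shows Tminus_le: "Tminus S c u y \<le> u x + S_coh S c (x, y)"
    and Tminus_attained: "\<exists>x. \<bar>y - x\<bar> \<le> step_bound \<bar>c\<bar> \<and> Tminus S c u y = u x + S_coh S c (x, y)"
proof -
  obtain x0 where x0: "\<And>z. u x0 + S_coh S c (x0, y) \<le> u z + S_coh S c (z, y)"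
    using minimizer_exists[OF assms] by blast
  then have bdd: "bdd_below (range (\<lambda>z. u z + S_coh S c (z, y)))"
    by (intro bdd_belowI[of _ "u x0 + S_coh S c (x0, y)"]) auto
  show le: "Tminus S c u y \<le> u x + S_coh S c (x, y)" for x
    unfolding Tminus_def by (rule cINF_lower[OF bdd]) simp
  have "u x0 + S_coh S c (x0, y) \<le> Tminus S c u y"
    unfolding Tminus_def using x0 by (intro cINF_greatest) auto
  then show "\<exists>x. \<bar>y - x\<bar> \<le> step_bound \<bar>c\<bar> \<and> Tminus S c u y = u x + S_coh S c (x, y)"
    using le[of x0] minimal_step_bound[of u c "\<bar>c\<bar>" x0 y, OF per _ x0]
    by (intro exI[of _ x0]) auto
qed

end

section \<open>Calibrated pairs\<close>

locale weak_KAM = twist_generating +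
  fixes c s :: real and u :: "real \<Rightarrow> real"
  assumes solution: "weak_KAM_with_constant S c s u"
begin

lemma u_continuous: "continuous_on UNIV u" and u_periodic: "u (x + 1) = u x"
  using solution by (auto simp: weak_KAM_with_constant_def)

text \<open>By how much the pair \<open>(x, y)\<close> misses being optimal in \<open>u = T\<^sup>-[u] - s\<close>.\<close>

definition defect :: "real \<times> real \<Rightarrow> real" where
  "defect z = u (fst z) + S_coh S c z - s - u (snd z)"

lemma u_fixed: "u x = Tminus S c u x - s"
  using solution unfolding weak_KAM_with_constant_def by blast

lemma defect_nonneg: "0 \<le> defect z"
  using Tminus_le[OF u_continuous u_periodic, of c "snd z" "fst z"] u_fixed[of "snd z"]
  by (simp add: defect_def)

lemma defect_continuous: "continuous_on UNIV defect"
  unfolding defect_def[abs_def]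
  by (intro continuous_intros S_coh_continuous continuous_on_compose2[OF u_continuous]) auto

lemma defect_periodic: "defect (x + 1, y + 1) = defect (x, y)"
  by (simp add: defect_def S_coh_periodic u_periodic)

definition calibrated :: "real \<Rightarrow> real \<Rightarrow> bool" where
  "calibrated x y \<longleftrightarrow> defect (x, y) = 0"

lemma calibrated_exists: "\<exists>x. calibrated x y"
proof -
  obtain x where "Tminus S c u y = u x + S_coh S c (x, y)"
    using Tminus_attained[OF u_continuous u_periodic] by blast
  then have "calibrated x y" using u_fixed[of y] by (simp add: defect_def calibrated_def)
  then show ?thesis by blast
qed

lemma calibrated_shift: "calibrated (x + 1) (y + 1) \<longleftrightarrow> calibrated x y"
  by (simp add: calibrated_def defect_periodic)

lemma calibrated_step_bound:
  assumes "calibrated x y" "\<bar>c\<bar> \<le> R"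
  shows "\<bar>y - x\<bar> \<le> step_bound R"
proof (rule minimal_step_bound[of u, OF u_periodic assms(2)])
  show "u x + S_coh S c (x, y) \<le> u z + S_coh S c (z, y)" for z
    using assms(1) defect_nonneg[of "(z, y)"] by (simp add: calibrated_def defect_def)
qed

lemma calibrated_touches:
  assumes "calibrated x y"
  shows "u t \<le> u x + S_coh S c (x, t) - s" "u y - S_coh S c (t, y) + s \<le> u t"
    "u y = u x + S_coh S c (x, y) - s"
  using assms defect_nonneg[of "(x, t)"] defect_nonneg[of "(t, y)"]
  by (auto simp: calibrated_def defect_def)

text \<open>From below, \<open>u\<close> is touched at \<open>x\<close> by the function expressing that the step from \<open>x\<close> to \<open>y\<close>
  is optimal; from above, by the one for an optimal step from some \<open>w\<close> to \<open>x\<close>.\<close>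

lemma calibrated_source_derivative:
  assumes "calibrated x y" and D: "((\<lambda>t. S (t, y)) has_real_derivative D) (at x)"
  shows "(u has_real_derivative - D - c) (at x)"
proof -
  obtain w where w: "calibrated w x" using calibrated_exists by blast
  have low: "((\<lambda>t. u y - S_coh S c (t, y) + s) has_real_derivative - D - c) (at x)"
    unfolding S_coh_def by (auto intro!: derivative_eq_intros D)
  have up: "((\<lambda>t. u w + S_coh S c (w, t) - s) has_real_derivative P (w, x) - c) (at x)"
    by (auto intro!: derivative_eq_intros S_coh_deriv2)
  show ?thesis
    by (rule touching_imp_derivative(2)[OF low up])
      (use calibrated_touches[OF assms(1)] calibrated_touches[OF w] in auto)
qed

lemma calibrated_not_Sing: "calibrated x y \<Longrightarrow> x \<notin> Sing u"
  using calibrated_source_derivative S_deriv1[of y x]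
  by (auto simp: Sing_def real_differentiable_def)

text \<open>Sources cannot be exchanged in order, since uncrossing would lower the action. They cannot
  coincide either: by calibrated_source_derivative, \<open>\<partial>\<^sub>1S(x, y)\<close> and \<open>\<partial>\<^sub>1S(x, y')\<close> would both be
  determined by the derivative of \<open>u\<close> at \<open>x\<close>, and the twist condition separates them.\<close>

lemma calibrated_strict_mono:
  assumes xy: "calibrated x y" and xy': "calibrated x' y'" and less: "y < y'"
  shows "x < x'"
proof -
  have sum: "S (x, y) + S (x', y') \<le> S (x', y) + S (x, y')"
    using calibrated_touches(2)[OF xy, of x'] calibrated_touches(3)[OF xy]
      calibrated_touches(2)[OF xy', of x] calibrated_touches(3)[OF xy']
    by (simp add: S_coh_def algebra_simps)
  have "\<not> x' < x"
  proof
    assume gt: "x' < x"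
    then have "0 < e * (x - x') * (y' - y)" using e_pos less by simp
    then show False using sum twist_gap[of x' x y y'] gt less by simp
  qed
  moreover have "x \<noteq> x'"
  proof
    assume eq: "x = x'"
    obtain D where D: "((\<lambda>t. S (t, y)) has_real_derivative D) (at x)" using S_deriv1 by blast
    obtain D' where D': "((\<lambda>t. S (t, y')) has_real_derivative D') (at x)" using S_deriv1 by blast
    have "- D - c = - D' - c"
      using calibrated_source_derivative[OF xy D] calibrated_source_derivative[OF xy'] D' eq
        DERIV_unique by blast
    then have DD: "D' = D" by simp
    \<comment> \<open>Strictly increasing at \<open>x\<close> to first order, but nonincreasing by \<open>twist_gap\<close>.\<close>
    define \<psi> where "\<psi> t = S (t, y') - S (t, y) + e * (y' - y) * t" for t
    have "(\<psi> has_real_derivative (D' - D) + e * (y' - y)) (at x)"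
      unfolding \<psi>_def by (auto intro!: derivative_eq_intros D D')
    then have "\<exists>d>0. \<forall>h>0. h < d \<longrightarrow> \<psi> x < \<psi> (x + h)"
      by (rule DERIV_pos_inc_right) (use DD e_pos less in simp)
    then obtain d where d: "d > 0" "\<And>h. 0 < h \<Longrightarrow> h < d \<Longrightarrow> \<psi> x < \<psi> (x + h)" by blast
    have "e * (y' - y) * (x + d / 2) = e * (y' - y) * x + e * (x + d / 2 - x) * (y' - y)"
      by algebra
    then have "\<psi> (x + d / 2) \<le> \<psi> x"
      using twist_gap[of x "x + d / 2" y y'] d(1) less unfolding \<psi>_def by linarith
    then show False using d(2)[of "d / 2"] d(1) by simp
  qed
  ultimately show ?thesis by simp
qed

text \<open>Each source \<open>w\<close> of \<open>y\<close> gives a smooth function touching \<open>u\<close> at \<open>y\<close> from above with slope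
  \<open>P (w, y) - c\<close>, and the twist condition makes these slopes differ for different sources.\<close>

lemma two_calibrated_imp_Sing:
  assumes "calibrated x y" "calibrated x' y" "x < x'"
  shows "y \<in> Sing u"
proof (rule ccontr)
  assume "y \<notin> Sing u"
  then obtain D where D: "(u has_real_derivative D) (at y)"
    by (auto simp: Sing_def real_differentiable_def)
  have "D = P (w, y) - c" if w: "calibrated w y" for w
  proof (rule touching_above_derivative[OF D])
    show "((\<lambda>t. u w + S_coh S c (w, t) - s) has_real_derivative P (w, y) - c) (at y)"
      by (auto intro!: derivative_eq_intros S_coh_deriv2)
  qed (use calibrated_touches[OF w] in auto)
  from this[OF assms(1)] this[OF assms(2)] have "P (x, y) = P (x', y)" by simp
  moreover have "0 < e * (x' - x)" using e_pos assms(3) by simp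
  ultimately show False using twist[of x x' y] assms(3) by simp
qed

end

section \<open>Countability of the singular set\<close>

context weak_KAM
begin

definition source :: "real \<Rightarrow> real" where
  "source y = (SOME x. calibrated x y)"

lemma calibrated_source: "calibrated (source y) y"
  unfolding source_def using calibrated_exists by (rule someI_ex)

lemma mono_source: "mono source"
  using calibrated_strict_mono[OF calibrated_source calibrated_source]
  by (intro monoI) (metis less_eq_real_def order_refl)

text \<open>The increments of \<open>u\<close> from \<open>y\<close> to \<open>t\<close> lie between those of the action with source \<open>source t\<close>
  and with source \<open>source y\<close>. Both have slope tending to \<open>P (source y, y) - c\<close> when \<open>source t\<close>
  tends to \<open>source y\<close>.\<close>

lemma differentiable_if_source_continuous:
  assumes "isCont source y"
  shows "y \<notin> Sing u"
proof -
  have "\<exists>\<xi>. \<forall>x t. \<bar>\<xi> x t - y\<bar> \<le> \<bar>t - y\<bar> \<and>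
      S_coh S c (x, t) - S_coh S c (x, y) = (t - y) * (P (x, \<xi> x t) - c)"
    by (rule choice, rule allI, rule choice, rule allI, rule S_coh_mean_value)
  then obtain \<xi> where \<xi>: "\<And>x t. \<bar>\<xi> x t - y\<bar> \<le> \<bar>t - y\<bar>"
    "\<And>x t. S_coh S c (x, t) - S_coh S c (x, y) = (t - y) * (P (x, \<xi> x t) - c)"
    by blast
  define D where "D = P (source y, y) - c"
  have lim\<xi>: "((\<lambda>t. \<xi> (w t) t) \<longlongrightarrow> y) (at y)" for w
  proof -
    have "((\<lambda>t. \<xi> (w t) t - y) \<longlongrightarrow> 0) (at y)"
    proof (rule Lim_null_comparison)
      show "\<forall>\<^sub>F t in at y. norm (\<xi> (w t) t - y) \<le> \<bar>t - y\<bar>"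
        using \<xi>(1) by (intro always_eventually) simp
      show "((\<lambda>t. \<bar>t - y\<bar>) \<longlongrightarrow> 0) (at y)" by (auto intro!: tendsto_eq_intros)
    qed
    then show ?thesis using LIM_zero_iff by blast
  qed
  have limP: "((\<lambda>t. P (w t, \<xi> (w t) t) - c) \<longlongrightarrow> D) (at y)" if "(w \<longlongrightarrow> source y) (at y)" for w
  proof -
    have "((\<lambda>t. (w t, \<xi> (w t) t)) \<longlongrightarrow> (source y, y)) (at y)"
      using that lim\<xi> by (rule tendsto_Pair)
    then have "((\<lambda>t. P (w t, \<xi> (w t) t)) \<longlongrightarrow> P (source y, y)) (at y)"
      using P_continuous
      by (intro isCont_tendsto_compose[of _ P]) (simp_all add: continuous_on_eq_continuous_at)
    then show ?thesis unfolding D_def by (intro tendsto_diff tendsto_const)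
  qed
  let ?a = "\<lambda>t. P (source y, \<xi> (source y) t) - c"
  let ?b = "\<lambda>t. P (source t, \<xi> (source t) t) - c"
  have a: "(?a \<longlongrightarrow> D) (at y)" by (rule limP) simp
  have b: "(?b \<longlongrightarrow> D) (at y)" by (rule limP) (use assms in \<open>simp add: isCont_def\<close>)
  have "((\<lambda>t. \<bar>?a t - D\<bar> + \<bar>?b t - D\<bar>) \<longlongrightarrow> \<bar>D - D\<bar> + \<bar>D - D\<bar>) (at y)"
    by (intro tendsto_intros a b)
  then have lim: "((\<lambda>t. \<bar>?a t - D\<bar> + \<bar>?b t - D\<bar>) \<longlongrightarrow> 0) (at y)" by simp
  have "((\<lambda>t. (u t - u y) / (t - y) - D) \<longlongrightarrow> 0) (at y)"
  proof (rule Lim_null_comparison[OF _ lim])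
    have "norm ((u t - u y) / (t - y) - D) \<le> \<bar>?a t - D\<bar> + \<bar>?b t - D\<bar>" if "t \<noteq> y" for t
    proof -
      have up: "u t - u y \<le> (t - y) * ?a t"
        using calibrated_touches(1)[OF calibrated_source, of t y] calibrated_touches(3)[OF calibrated_source, of y]
          \<xi>(2)[of "source y" t] by linarith
      have low: "(t - y) * ?b t \<le> u t - u y"
        using calibrated_touches(1)[OF calibrated_source, of y t] calibrated_touches(3)[OF calibrated_source, of t]
          \<xi>(2)[of "source t" t] by linarith
      show ?thesis
      proof (cases "t > y")
        case True
        then have "?b t \<le> (u t - u y) / (t - y)" "(u t - u y) / (t - y) \<le> ?a t"
          using up low by (simp_all add: field_simps)
        then show ?thesis by (simp add: abs_if)
      next
        case False
        then have "t - y < 0" using that by simp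
        then have "?a t \<le> (u t - u y) / (t - y)" "(u t - u y) / (t - y) \<le> ?b t"
          using up low by (simp_all add: neg_le_divide_eq neg_divide_le_eq mult.commute)
        then show ?thesis by (simp add: abs_if)
      qed
    qed
    then show "\<forall>\<^sub>F t in at y. norm ((u t - u y) / (t - y) - D) \<le> \<bar>?a t - D\<bar> + \<bar>?b t - D\<bar>"
      by (auto simp: eventually_at_filter)
  qed
  then have "(u has_real_derivative D) (at y)"
    unfolding has_field_derivative_iff using LIM_zero_iff by blast
  then show ?thesis by (auto simp: Sing_def real_differentiable_def)
qed

text \<open>The sources are increasing functions of the target, and a monotone function has only
  countably many discontinuities.\<close>

lemma countable_Sing: "countable (Sing u)"
  using mono_ctble_discont[OF mono_source] differentiable_if_source_continuous
  by (auto intro: countable_subset[rotated])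

section \<open>The circle map carried by a weak K.A.M. solution\<close>

lemma closed_targets:
  assumes "closed D"
  shows "closed {y. \<exists>x\<in>D. calibrated x y}"
proof -
  let ?K = "step_bound \<bar>c\<bar>"
  let ?T = "{z. snd z + fst z \<in> D \<and> defect (snd z + fst z, snd z) = 0}"
  have T: "closed ?T"
  proof (rule closed_Collect_conj)
    have "closed ((\<lambda>z::real \<times> real. snd z + fst z) -` D)"
      by (intro continuous_closed_vimage assms) (auto intro!: continuous_intros)
    then show "closed {z::real \<times> real. snd z + fst z \<in> D}" by (simp add: vimage_def)
    show "closed {z. defect (snd z + fst z, snd z) = 0}"
      by (intro closed_Collect_eq continuous_intros continuous_on_compose2[OF defect_continuous]) auto
  qed
  have "{y. \<exists>x\<in>D. calibrated x y} = {y. \<exists>t. t \<in> {- ?K..?K} \<and> (t, y) \<in> ?T}"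
  proof (intro set_eqI iffI)
    fix y assume "y \<in> {y. \<exists>x\<in>D. calibrated x y}"
    then obtain x where "x \<in> D" "calibrated x y" by blast
    then show "y \<in> {y. \<exists>t. t \<in> {- ?K..?K} \<and> (t, y) \<in> ?T}"
      using calibrated_step_bound[of x y "\<bar>c\<bar>"]
      by (intro CollectI exI[of _ "x - y"]) (auto simp: calibrated_def abs_le_iff)
  qed (auto simp: calibrated_def)
  then show ?thesis using closed_compact_projection[OF compact_Icc T] by simp
qed

text \<open>The sources of \<open>y\<close> span an interval, and these intervals tile the line as \<open>y\<close> varies.\<close>

definition straddles :: "real \<Rightarrow> real \<Rightarrow> bool" where
  "straddles y x \<longleftrightarrow> (\<exists>a\<in>{..x}. calibrated a y) \<and> (\<exists>b\<in>{x..}. calibrated b y)"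

text \<open>The targets with a source to the left of \<open>x\<close> and those with a source to the right form two
  closed sets, a lower and an upper one, and together they cover the line; so they meet.\<close>

lemma straddles_exists: "\<exists>y. straddles y x"
proof -
  let ?K = "step_bound \<bar>c\<bar>"
  define A where "A = {y. \<exists>a\<in>{..x}. calibrated a y}"
  define B where "B = {y. \<exists>b\<in>{x..}. calibrated b y}"
  have A: "closed A" and B: "closed B" unfolding A_def B_def by (intro closed_targets; simp)+
  have K: "\<bar>y - a\<bar> \<le> ?K" if "calibrated a y" for a y
    using calibrated_step_bound[OF that, of "\<bar>c\<bar>"] by simp
  have "x - ?K \<in> A"
    using calibrated_source[of "x - ?K"] K[OF calibrated_source, of "x - ?K"]
    unfolding A_def by (intro CollectI bexI[of _ "source (x - ?K)"]) auto
  moreover have bdd: "bdd_above A"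
    using K unfolding A_def by (intro bdd_aboveI[of _ "x + ?K"]) (fastforce simp: abs_le_iff)
  ultimately have SA: "Sup A \<in> A" using closed_contains_Sup[of A] A by blast
  have "{Sup A<..} \<subseteq> B"
  proof
    fix y assume "y \<in> {Sup A<..}"
    then have "y \<notin> A" using cSup_upper[OF _ bdd] by force
    then show "y \<in> B" using calibrated_source[of y] unfolding A_def B_def by force
  qed
  then have "closure {Sup A<..} \<subseteq> B" using B by (rule closure_minimal)
  then have "Sup A \<in> B" by auto
  then show ?thesis using SA unfolding A_def B_def straddles_def by blast
qed

lemma straddles_mono:
  assumes "straddles y x" "straddles y' x'" "x \<le> x'"
  shows "y \<le> y'"
  using assms calibrated_strict_mono unfolding straddles_def by fastforce

text \<open>On the sources this is the twist map acting on the graph of \<open>c + u'\<close>, read on the base. The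
  whole interval spanned by the sources of one point is collapsed to that point.\<close>

definition forward :: "real \<Rightarrow> real" where
  "forward x = (SOME y. straddles y x)"

lemma straddles_forward: "straddles (forward x) x"
  unfolding forward_def using straddles_exists by (rule someI_ex)

lemma forward_unique: "straddles y x \<Longrightarrow> forward x = y"
  using straddles_mono straddles_forward by (meson order_antisym order_refl)

lemma forward_calibrated: "calibrated x y \<Longrightarrow> forward x = y"
  by (rule forward_unique) (auto simp: straddles_def)

lemma mono_forward: "mono forward"
  using straddles_mono[OF straddles_forward straddles_forward] by (auto intro: monoI)

lemma forward_shift: "forward (x + 1) = forward x + 1"
proof (rule forward_unique)
  obtain a b where "a \<le> x" "x \<le> b" "calibrated a (forward x)" "calibrated b (forward x)"
    using straddles_forward[of x] by (auto simp: straddles_def)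
  then show "straddles (forward x + 1) (x + 1)"
    unfolding straddles_def
    by (intro conjI bexI[of _ "a + 1"] bexI[of _ "b + 1"]) (auto simp: calibrated_shift)
qed

lemma continuous_forward: "continuous_on UNIV forward"
proof (rule continuous_onI_mono)
  have "range forward = UNIV" using forward_calibrated[OF calibrated_source] by (metis surjI)
  then show "open (range forward)" by simp
qed (use mono_forward in \<open>auto dest: monoD\<close>)

text \<open>A singular point is no source at all, so it lies strictly inside the interval spanned by the
  sources of its image, and that image then has several sources.\<close>

lemma forward_Sing:
  assumes "x \<in> Sing u"
  shows "forward x \<in> Sing u"
proof -
  obtain a b where ab: "a \<le> x" "x \<le> b" "calibrated a (forward x)" "calibrated b (forward x)"
    using straddles_forward[of x] by (auto simp: straddles_def)
  have "a \<noteq> x" using ab(3) assms calibrated_not_Sing by blast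
  then show ?thesis using two_calibrated_imp_Sing[OF ab(3,4)] ab(1,2) by simp
qed

lemma mono_forward_iterate: "mono (forward ^^ n)"
  by (rule mono_pow) (rule mono_forward)

lemma continuous_forward_iterate: "continuous_on UNIV (forward ^^ n)"
proof (induction n)
  case (Suc n)
  then show ?case
    using continuous_on_compose[OF Suc continuous_on_subset[OF continuous_forward]] by simp
qed (simp add: continuous_on_id)

lemma forward_iterate_shift: "(forward ^^ n) (x + 1) = (forward ^^ n) x + 1"
  by (induction n) (simp_all add: forward_shift)

lemma forward_iterate_shift_int: "(forward ^^ n) (x + of_int k) = (forward ^^ n) x + of_int k"
  using periodic_int[of "\<lambda>x. (forward ^^ n) x - x" x k] by (simp add: forward_iterate_shift)

lemma forward_iterate_Sing: "x \<in> Sing u \<Longrightarrow> (forward ^^ n) x \<in> Sing u"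
  by (induction n) (simp_all add: forward_Sing)

lemma finite_Sing_periodic:
  assumes "Sing_mod u \<noteq> {}" and fin: "finite (Sing_mod u)"
  obtains q :: nat and p :: int and x where "q > 0" "(forward ^^ q) x = x + of_int p"
proof -
  obtain x where x: "x \<in> Sing u" using assms(1) by (auto simp: Sing_mod_def)
  have "range (\<lambda>n. to_circle ((forward ^^ n) x)) \<subseteq> Sing_mod u"
    using forward_iterate_Sing[OF x] by (auto simp: Sing_mod_def)
  then have "finite (range (\<lambda>n. to_circle ((forward ^^ n) x)))" using fin finite_subset by blast
  then have "\<not> inj (\<lambda>n. to_circle ((forward ^^ n) x))" using finite_imageD by blast
  then obtain m n where "m < n" "to_circle ((forward ^^ n) x) = to_circle ((forward ^^ m) x)"
    unfolding inj_def by (metis linorder_neqE_nat)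
  then obtain k where k: "(forward ^^ n) x = (forward ^^ m) x + of_int k"
    using to_circle_eq_iff by blast
  have "n = (n - m) + m" using \<open>m < n\<close> by simp
  then have "(forward ^^ n) x = (forward ^^ (n - m)) ((forward ^^ m) x)"
    by (metis comp_apply funpow_add)
  then show ?thesis using that[of "n - m" "(forward ^^ m) x" k] k \<open>m < n\<close> by simp
qed

text \<open>The translates of the periodic orbit confine every other orbit between them.\<close>

lemma iterate_displacement:
  assumes per: "(forward ^^ q) x = x + of_int p"
  shows "\<bar>(forward ^^ (n * q)) y - y - real n * of_int p\<bar> \<le> 1"
proof -
  have x: "(forward ^^ (n * q)) x = x + of_int (int n * p)" for n
  proof (induction n)
    case (Suc n)
    have "(forward ^^ (Suc n * q)) x = (forward ^^ q) ((forward ^^ (n * q)) x)"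
      by (simp add: funpow_add)
    also have "\<dots> = x + of_int p + of_int (int n * p)"
      unfolding Suc.IH forward_iterate_shift_int per by simp
    finally show ?case by (simp add: algebra_simps)
  qed simp
  define k where "k = \<lfloor>y - x\<rfloor>"
  have k: "x + of_int k \<le> y" "y \<le> x + of_int (k + 1)" unfolding k_def by linarith+
  have "(forward ^^ (n * q)) (x + of_int k) \<le> (forward ^^ (n * q)) y"
    "(forward ^^ (n * q)) y \<le> (forward ^^ (n * q)) (x + of_int (k + 1))"
    using k monoD[OF mono_forward_iterate] by blast+
  then show ?thesis using k unfolding forward_iterate_shift_int x by (auto simp: abs_le_iff)
qed

text \<open>Averaging the first \<open>J\<close> iterates of \<open>forward\<close> nearly conjugates it to the rotation by
  \<open>p / q\<close>: the average advances by \<open>(forward\<^sup>J x - x) / J\<close> at each step, which is within \<open>1 / J\<close>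
  of \<open>p / q\<close> when \<open>q\<close> divides \<open>J\<close>. Calibrated pairs follow \<open>forward\<close>, and for the other pairs the
  defect pays for the deviation.\<close>

lemma approximate_conjugacy:
  assumes q: "q > 0" and per: "(forward ^^ q) x0 = x0 + of_int p" and eps: "\<epsilon> > 0"
  obtains \<psi> B C where "\<And>x. \<bar>\<psi> x - x\<bar> \<le> B" "C \<ge> 0"
    "\<And>x y. \<bar>y - x\<bar> \<le> K \<Longrightarrow> \<bar>\<psi> y - \<psi> x - of_int p / real q\<bar> \<le> \<epsilon> + C * defect (x, y)"
proof -
  let ?\<rho> = "of_int p / real q"
  obtain n :: nat where n: "n > 0" "1 / real n < \<epsilon> / 2"
    using reals_Archimedean[of "\<epsilon> / 2"] eps by (metis half_gt_zero inverse_eq_divide zero_less_Suc)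
  define J where "J = n * q"
  have J: "J > 0" "1 / real J \<le> 1 / real n"
    using n(1) q by (auto simp: J_def field_simps)
  define \<psi> where "\<psi> x = (\<Sum>j<J. (forward ^^ j) x) / real J" for x
  have step: "\<bar>\<psi> y - \<psi> x - ?\<rho>\<bar> \<le> 1 / real n" if "defect (x, y) = 0" for x y
  proof -
    have y: "forward x = y" using that forward_calibrated by (simp add: calibrated_def)
    have "\<psi> y - \<psi> x = (\<Sum>j<J. (forward ^^ Suc j) x - (forward ^^ j) x) / real J"
      by (simp add: \<psi>_def y[symmetric] funpow_swap1 sum_subtractf diff_divide_distrib)
    also have "\<dots> = ((forward ^^ J) x - x) / real J"
      by (subst sum_lessThan_telescope) simp
    moreover have "?\<rho> = real n * of_int p / real J" using n(1) by (simp add: J_def)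
    ultimately have "\<psi> y - \<psi> x - ?\<rho> = ((forward ^^ J) x - x - real n * of_int p) / real J"
      by (simp add: diff_divide_distrib)
    then have "\<bar>\<psi> y - \<psi> x - ?\<rho>\<bar> \<le> 1 / real J"
      using iterate_displacement[OF per, of n x] J(1) by (simp add: J_def divide_right_mono)
    then show ?thesis using J(2) by linarith
  qed
  have \<psi>_shift: "\<psi> (x + 1) = \<psi> x + 1" for x
    using J(1) by (simp add: \<psi>_def forward_iterate_shift sum.distrib add_divide_distrib)
  have \<psi>_cont: "continuous_on UNIV \<psi>"
    unfolding \<psi>_def[abs_def] using J(1)
    by (intro continuous_intros continuous_forward_iterate) auto
  obtain B where B: "\<And>x. \<bar>\<psi> x - x\<bar> \<le> B"
    using periodic_bounded[of "\<lambda>x. \<psi> x - x"] \<psi>_shift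
      continuous_on_diff[OF \<psi>_cont continuous_on_id] by auto
  let ?h = "\<lambda>z. \<bar>\<psi> (snd z) - \<psi> (fst z) - ?\<rho>\<bar>"
  have hc: "continuous_on UNIV ?h"
    by (intro continuous_intros continuous_on_compose2[OF \<psi>_cont]) auto
  have "\<exists>C\<ge>0. \<forall>z\<in>strip_cell K. ?h z \<le> 1 / real n + \<epsilon> / 2 + C * defect z"
  proof (rule penalty_bound[OF compact_strip_cell])
    show "continuous_on (strip_cell K) ?h" "continuous_on (strip_cell K) defect"
      using hc defect_continuous continuous_on_subset by blast+
    show "?h z \<le> 1 / real n" if "defect z = 0" for z
      using step[of "fst z" "snd z"] that by simp
  qed (use defect_nonneg eps in auto)
  then obtain C where C: "C \<ge> 0"
    "\<And>z. z \<in> strip_cell K \<Longrightarrow> ?h z \<le> 1 / real n + \<epsilon> / 2 + C * defect z" by blast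
  have "\<bar>\<psi> y - \<psi> x - ?\<rho>\<bar> \<le> \<epsilon> + C * defect (x, y)" if xy: "\<bar>y - x\<bar> \<le> K" for x y
  proof -
    obtain k where k: "(x + of_int k, y + of_int k) \<in> strip_cell K"
      using diagonal_periodic_reduce[OF xy] .
    have "?h (x + of_int k, y + of_int k) = ?h (x, y)"
      using diagonal_periodic_int[of ?h x k y] by (simp add: \<psi>_shift)
    moreover have "defect (x + of_int k, y + of_int k) = defect (x, y)"
      by (rule diagonal_periodic_int) (rule defect_periodic)
    ultimately show ?thesis using C(2)[OF k] n(2) by simp
  qed
  then show ?thesis using that B C(1) by blast
qed

end

section \<open>Mather's function along calibrated orbits\<close>

context weak_KAM
begin

definition orbit :: "nat \<Rightarrow> real" where
  "orbit n = (source ^^ n) 0"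

lemma calibrated_orbit: "calibrated (orbit (Suc n)) (orbit n)"
  by (simp add: orbit_def calibrated_source)

lemma orbit_bound:
  assumes "\<bar>c\<bar> \<le> R"
  shows "\<bar>orbit 0 - orbit n\<bar> \<le> real n * step_bound R"
proof (induction n)
  case (Suc n)
  then show ?case
    using calibrated_step_bound[OF calibrated_orbit assms, of n] by (simp add: algebra_simps)
qed simp

end

text \<open>Orbits calibrated for \<open>u\<close> at class \<open>c\<close> are tested with the defect of \<open>u'\<close> at class \<open>c'\<close>.\<close>

locale weak_KAM_pair = weak_KAM + other: weak_KAM S P e c' s' u' for c' s' u'
begin

lemma defect_sum:
  "(\<Sum>k<n. other.defect (orbit (Suc k), orbit k)) =
    (u' (orbit n) - u (orbit n)) - (u' (orbit 0) - u (orbit 0))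
    + (c - c') * (orbit 0 - orbit n) + real n * (s - s')"
proof (induction n)
  case (Suc n)
  have "other.defect (orbit (Suc n), orbit n) =
    (u' (orbit (Suc n)) - u (orbit (Suc n))) - (u' (orbit n) - u (orbit n))
    + (c - c') * (orbit n - orbit (Suc n)) + (s - s')"
    using calibrated_orbit[of n]
    by (simp add: other.defect_def defect_def calibrated_def S_coh_def algebra_simps)
  then show ?case using Suc by (simp add: algebra_simps)
qed simp

lemma defect_sum_approx:
  obtains B where "\<And>n. \<bar>(\<Sum>k<n. other.defect (orbit (Suc k), orbit k))
      - ((c - c') * (orbit 0 - orbit n) + real n * (s - s'))\<bar> \<le> B"
proof -
  obtain B where B: "\<And>x. \<bar>u x\<bar> \<le> B" using periodic_bounded[OF u_periodic u_continuous] by blast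
  obtain B' where B': "\<And>x. \<bar>u' x\<bar> \<le> B'"
    using periodic_bounded[OF other.u_periodic other.u_continuous] by blast
  have "\<bar>(\<Sum>k<n. other.defect (orbit (Suc k), orbit k))
      - ((c - c') * (orbit 0 - orbit n) + real n * (s - s'))\<bar> \<le> 2 * B + 2 * B'" for n
    unfolding defect_sum using B[of "orbit n"] B[of "orbit 0"] B'[of "orbit n"] B'[of "orbit 0"]
    by (simp add: abs_le_iff)
  then show ?thesis using that by blast
qed

text \<open>The defects along the orbit have a nonnegative sum, which is affine in the displacement of
  the orbit and in the number \<open>n\<close> of steps up to a bounded error. Divide by \<open>n\<close>.\<close>

lemma constant_estimate:
  assumes rot: "\<And>n. \<bar>orbit 0 - orbit n - real n * \<rho>\<bar> \<le> B + real n * \<eta>"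
  shows "s' - s \<le> \<rho> * (c - c') + \<bar>c - c'\<bar> * \<eta>"
proof -
  obtain B1 where B1: "\<And>n. \<bar>(\<Sum>k<n. other.defect (orbit (Suc k), orbit k))
      - ((c - c') * (orbit 0 - orbit n) + real n * (s - s'))\<bar> \<le> B1"
    using defect_sum_approx by blast
  show ?thesis
  proof (rule le_of_nat_mult_le)
    fix n
    have "0 \<le> (\<Sum>k<n. other.defect (orbit (Suc k), orbit k))"
      by (intro sum_nonneg other.defect_nonneg)
    then have "real n * (s' - s) \<le> B1 + (c - c') * (orbit 0 - orbit n)"
      using B1[of n] by (simp add: algebra_simps abs_le_iff)
    moreover have "\<bar>(c - c') * (orbit 0 - orbit n - real n * \<rho>)\<bar> \<le> \<bar>c - c'\<bar> * (B + real n * \<eta>)"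
      unfolding abs_mult using rot by (intro mult_left_mono) auto
    then have "(c - c') * (orbit 0 - orbit n)
        \<le> real n * (\<rho> * (c - c')) + \<bar>c - c'\<bar> * (B + real n * \<eta>)"
      by (simp add: algebra_simps abs_le_iff)
    ultimately show "real n * (s' - s) \<le>
        (B1 + \<bar>c - c'\<bar> * B) + real n * (\<rho> * (c - c') + \<bar>c - c'\<bar> * \<eta>)"
      by (simp add: algebra_simps)
  qed
qed

lemma constant_lipschitz_one_sided:
  assumes "\<bar>c\<bar> \<le> R"
  shows "s' - s \<le> step_bound R * \<bar>c - c'\<bar>"
  using constant_estimate[of 0 0 "step_bound R"] orbit_bound[OF assms] by (simp add: mult.commute)

end

context twist_generating
begin

lemma constant_lipschitz:
  assumes u: "weak_KAM_with_constant S c s u" and u': "weak_KAM_with_constant S c' s' u'"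
    and "\<bar>c\<bar> \<le> R" "\<bar>c'\<bar> \<le> R"
  shows "\<bar>s - s'\<bar> \<le> step_bound R * \<bar>c - c'\<bar>"
proof -
  interpret A: weak_KAM_pair S P e c s u c' s' u'
    by (intro weak_KAM_pair.intro weak_KAM.intro weak_KAM_axioms.intro twist_generating_axioms u u')
  interpret B: weak_KAM_pair S P e c' s' u' c s u
    by (intro weak_KAM_pair.intro weak_KAM.intro weak_KAM_axioms.intro twist_generating_axioms u u')
  show ?thesis
    using A.constant_lipschitz_one_sided[OF assms(3)] B.constant_lipschitz_one_sided[OF assms(4)]
    by (simp add: abs_le_iff abs_minus_commute)
qed

lemma constant_unique:
  "weak_KAM_with_constant S c s u \<Longrightarrow> weak_KAM_with_constant S c s' u' \<Longrightarrow> s = s'"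
  using constant_lipschitz[of c s u c s' u' "\<bar>c\<bar>"] by simp

lemma S_bar_eq:
  assumes "weak_KAM_with_constant S c s u"
  shows "S_bar S c = s"
  unfolding S_bar_def using assms constant_unique by blast

end

context weak_KAM_pair
begin

text \<open>Along an orbit calibrated for \<open>u\<close>, the total defect for \<open>u'\<close> grows at most at the rate
  \<open>2 K \<bar>c - c'\<bar>\<close>. Hence an approximate conjugacy for \<open>u'\<close> controls the rotation of orbits
  belonging to a nearby class as well.\<close>

lemma orbit_rotation:
  assumes \<psi>: "\<And>x. \<bar>\<psi> x - x\<bar> \<le> B" and C: "C \<ge> 0"
    and cor: "\<And>x y. \<bar>y - x\<bar> \<le> step_bound R \<Longrightarrow>
      \<bar>\<psi> y - \<psi> x - \<rho>\<bar> \<le> \<epsilon> + C * other.defect (x, y)"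
    and R: "\<bar>c\<bar> \<le> R" "\<bar>c'\<bar> \<le> R"
  obtains B' where "\<And>n. \<bar>orbit 0 - orbit n - real n * \<rho>\<bar>
    \<le> B' + real n * (\<epsilon> + 2 * C * step_bound R * \<bar>c - c'\<bar>)"
proof -
  let ?K = "step_bound R"
  obtain B1 where B1: "\<And>n. \<bar>(\<Sum>k<n. other.defect (orbit (Suc k), orbit k))
      - ((c - c') * (orbit 0 - orbit n) + real n * (s - s'))\<bar> \<le> B1"
    using defect_sum_approx by blast
  have "\<bar>orbit 0 - orbit n - real n * \<rho>\<bar>
    \<le> (2 * B + C * B1) + real n * (\<epsilon> + 2 * C * ?K * \<bar>c - c'\<bar>)" for n
  proof -
    let ?D = "\<Sum>k<n. other.defect (orbit (Suc k), orbit k)"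
    have tel: "\<psi> (orbit 0) - \<psi> (orbit n) - real n * \<rho>
      = (\<Sum>k<n. \<psi> (orbit k) - \<psi> (orbit (Suc k)) - \<rho>)"
      using sum_lessThan_telescope'[of "\<lambda>k. \<psi> (orbit k)" n] by (simp only: sum_subtractf) simp
    have "\<bar>\<psi> (orbit 0) - \<psi> (orbit n) - real n * \<rho>\<bar>
        \<le> (\<Sum>k<n. \<epsilon> + C * other.defect (orbit (Suc k), orbit k))"
      unfolding tel by (rule order_trans[OF sum_abs], intro sum_mono cor
          calibrated_step_bound[OF calibrated_orbit R(1)])
    also have "\<dots> = real n * \<epsilon> + C * ?D"
      by (simp only: sum.distrib sum_distrib_left[symmetric] sum_constant card_lessThan)
    finally have 1: "\<bar>\<psi> (orbit 0) - \<psi> (orbit n) - real n * \<rho>\<bar> \<le> real n * \<epsilon> + C * ?D" .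
    have "\<bar>(c - c') * (orbit 0 - orbit n)\<bar> \<le> \<bar>c - c'\<bar> * (real n * ?K)"
      unfolding abs_mult by (intro mult_left_mono orbit_bound R(1)) simp
    moreover have "real n * (s - s') \<le> real n * (?K * \<bar>c - c'\<bar>)"
      using constant_lipschitz[OF solution other.solution R] by (intro mult_left_mono) auto
    ultimately have "?D \<le> B1 + real n * (2 * ?K * \<bar>c - c'\<bar>)"
      using B1[of n] by (simp add: abs_le_iff algebra_simps)
    then have "C * ?D \<le> C * (B1 + real n * (2 * ?K * \<bar>c - c'\<bar>))"
      using C by (rule mult_left_mono)
    then show ?thesis
      using 1 \<psi>[of "orbit 0"] \<psi>[of "orbit n"] by (simp add: abs_le_iff algebra_simps)
  qed
  then show ?thesis using that by blast
qed

end

text \<open>The orbit calibrated at \<open>c\<close> gives one inequality, the orbit calibrated at \<open>c'\<close> the other.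
  Both have rotation close to \<open>p / q\<close>, by the same approximate conjugacy at \<open>c\<close>. The constant \<open>C\<close>
  depends on \<open>\<epsilon>\<close> but not on \<open>c'\<close>.\<close>

lemma (in weak_KAM) constant_expansion:
  assumes q: "q > 0" and per: "(forward ^^ q) x0 = x0 + of_int p" and eps: "\<epsilon> > 0"
  obtains C where "C \<ge> 0"
    "\<And>c' s' u'. \<lbrakk>\<bar>c' - c\<bar> \<le> 1; weak_KAM_with_constant S c' s' u'\<rbrakk> \<Longrightarrow>
      \<bar>(s - s') - of_int p / real q * (c' - c)\<bar> \<le> \<bar>c' - c\<bar> * (\<epsilon> + C * \<bar>c' - c\<bar>)"
proof -
  define \<rho> where "\<rho> = of_int p / real q"
  define R where "R = \<bar>c\<bar> + 1"
  let ?K = "step_bound R"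
  obtain \<psi> B C where \<psi>: "\<And>x. \<bar>\<psi> x - x\<bar> \<le> B" and C: "C \<ge> 0" and
    cor: "\<And>x y. \<bar>y - x\<bar> \<le> ?K \<Longrightarrow> \<bar>\<psi> y - \<psi> x - \<rho>\<bar> \<le> \<epsilon> + C * defect (x, y)"
    using approximate_conjugacy[OF q per eps, of ?K] unfolding \<rho>_def by metis
  have "\<bar>(s - s') - \<rho> * (c' - c)\<bar> \<le> \<bar>c' - c\<bar> * (\<epsilon> + 2 * C * ?K * \<bar>c' - c\<bar>)"
    if c': "\<bar>c' - c\<bar> \<le> 1" and u': "weak_KAM_with_constant S c' s' u'" for c' s' u'
  proof -
    have R: "\<bar>c\<bar> \<le> R" "\<bar>c'\<bar> \<le> R" using c' unfolding R_def by linarith+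
    interpret self: weak_KAM_pair S P e c s u c s u
      by (intro weak_KAM_pair.intro weak_KAM_axioms)
    interpret A: weak_KAM_pair S P e c s u c' s' u'
      by (intro weak_KAM_pair.intro weak_KAM.intro weak_KAM_axioms.intro
          twist_generating_axioms solution u')
    interpret B: weak_KAM_pair S P e c' s' u' c s u
      by (intro weak_KAM_pair.intro weak_KAM.intro weak_KAM_axioms.intro
          twist_generating_axioms solution u')
    \<comment> \<open>The pair formed by \<open>u\<close> and itself: the orbit at \<open>c\<close> has zero defect.\<close>
    obtain B1 where "\<And>n. \<bar>orbit 0 - orbit n - real n * \<rho>\<bar>
        \<le> B1 + real n * (\<epsilon> + 2 * C * ?K * \<bar>c - c\<bar>)"
      using self.orbit_rotation[OF \<psi> C cor R(1) R(1)] by blast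
    then have low: "s' - s \<le> \<rho> * (c - c') + \<bar>c - c'\<bar> * \<epsilon>"
      using A.constant_estimate[of \<rho> B1 \<epsilon>] by simp
    obtain B2 where "\<And>n. \<bar>A.other.orbit 0 - A.other.orbit n - real n * \<rho>\<bar>
        \<le> B2 + real n * (\<epsilon> + 2 * C * ?K * \<bar>c' - c\<bar>)"
      using B.orbit_rotation[OF \<psi> C cor R(2) R(1)] by blast
    then have up: "s - s' \<le> \<rho> * (c' - c) + \<bar>c' - c\<bar> * (\<epsilon> + 2 * C * ?K * \<bar>c' - c\<bar>)"
      by (rule B.constant_estimate)
    have "0 \<le> \<bar>c' - c\<bar> * (2 * C * ?K * \<bar>c' - c\<bar>)"
      using C step_bound_ge1[of R] by (intro mult_nonneg_nonneg) auto
    then show ?thesis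
      using low up by (simp add: abs_le_iff abs_minus_commute algebra_simps)
  qed
  moreover have "2 * C * ?K \<ge> 0" using C step_bound_ge1[of R] by simp
  ultimately show ?thesis using that unfolding \<rho>_def by blast
qed

section \<open>Existence of weak K.A.M. solutions\<close>

context twist_generating
begin

lemma Tminus_periodic:
  assumes "continuous_on UNIV w" and per: "\<And>x. w (x + 1) = w x"
  shows "Tminus S c w (y + 1) = Tminus S c w y"
proof (rule antisym)
  obtain x where "Tminus S c w y = w x + S_coh S c (x, y)"
    using Tminus_attained[OF assms] by blast
  then show "Tminus S c w (y + 1) \<le> Tminus S c w y"
    using Tminus_le[OF assms, of c "y + 1" "x + 1"] by (simp add: per S_coh_periodic)
  obtain x where "Tminus S c w (y + 1) = w x + S_coh S c (x, y + 1)"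
    using Tminus_attained[OF assms] by blast
  then show "Tminus S c w y \<le> Tminus S c w (y + 1)"
    using Tminus_le[OF assms, of c y "x - 1"] per[of "x - 1"] S_coh_periodic[of c "x - 1" y] by simp
qed

lemma Tminus_mono:
  assumes w: "continuous_on UNIV w" "\<And>x. w (x + 1) = w x"
    and w': "continuous_on UNIV w'" "\<And>x. w' (x + 1) = w' x"
    and le: "\<And>x. w x \<le> w' x + k"
  shows "Tminus S c w y \<le> Tminus S c w' y + k"
proof -
  obtain x where "Tminus S c w' y = w' x + S_coh S c (x, y)"
    using Tminus_attained[OF w'] by blast
  then show ?thesis using Tminus_le[OF w, of c y x] le[of x] by simp
qed

text \<open>Optimal steps have bounded length, so \<open>T\<^sup>-[w]\<close> is a minimum of functions that
  are Lipschitz with a constant independent of \<open>w\<close>.\<close>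

lemma Tminus_lipschitz:
  "\<exists>L\<ge>0. \<forall>w. continuous_on UNIV w \<longrightarrow> (\<forall>x. w (x + 1) = w x) \<longrightarrow>
     (\<forall>y t. \<bar>t - y\<bar> \<le> 1 \<longrightarrow> Tminus S c w t - Tminus S c w y \<le> L * \<bar>t - y\<bar>)"
proof -
  let ?K = "step_bound \<bar>c\<bar>"
  obtain B where B: "B \<ge> 0" "\<And>x y. \<bar>y - x\<bar> \<le> ?K + 1 \<Longrightarrow> \<bar>P (x, y)\<bar> \<le> B"
    using diagonal_periodic_bounded[of P, OF P_periodic P_continuous] by blast
  have "Tminus S c w t - Tminus S c w y \<le> (B + \<bar>c\<bar>) * \<bar>t - y\<bar>"
    if w: "continuous_on UNIV w" "\<And>x. w (x + 1) = w x" and ty: "\<bar>t - y\<bar> \<le> 1" for w t y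
  proof -
    obtain x where x: "\<bar>y - x\<bar> \<le> ?K" "Tminus S c w y = w x + S_coh S c (x, y)"
      using Tminus_attained[OF w] by blast
    obtain \<xi> where \<xi>: "\<bar>\<xi> - y\<bar> \<le> \<bar>t - y\<bar>"
      "S_coh S c (x, t) - S_coh S c (x, y) = (t - y) * (P (x, \<xi>) - c)"
      using S_coh_mean_value by blast
    have "\<bar>P (x, \<xi>)\<bar> \<le> B" using \<xi>(1) x(1) ty by (intro B(2)) linarith
    then have "\<bar>(t - y) * (P (x, \<xi>) - c)\<bar> \<le> \<bar>t - y\<bar> * (B + \<bar>c\<bar>)"
      unfolding abs_mult by (intro mult_left_mono) auto
    then show ?thesis
      using Tminus_le[OF w, of c t x] x(2) \<xi>(2) by (simp add: mult.commute abs_le_iff)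
  qed
  then show ?thesis using B(1) by (intro exI[of _ "B + \<bar>c\<bar>"]) auto
qed

definition lipschitz_const :: "real \<Rightarrow> real" where
  "lipschitz_const c = (SOME L. L \<ge> 0 \<and> (\<forall>w. continuous_on UNIV w \<longrightarrow> (\<forall>x. w (x + 1) = w x) \<longrightarrow>
     (\<forall>y t. \<bar>t - y\<bar> \<le> 1 \<longrightarrow> Tminus S c w t - Tminus S c w y \<le> L * \<bar>t - y\<bar>)))"

text \<open>By periodicity, the bound at distance at most 1 already controls the oscillation.\<close>

definition lip_periodic :: "real \<Rightarrow> (real \<Rightarrow> real) \<Rightarrow> bool" where
  "lip_periodic c w \<longleftrightarrow> (\<forall>x. w (x + 1) = w x) \<and>
     (\<forall>x y. \<bar>x - y\<bar> \<le> 1 \<longrightarrow> w x - w y \<le> lipschitz_const c * \<bar>x - y\<bar>)"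

lemma lipschitz_const_nonneg: "lipschitz_const c \<ge> 0"
  and Tminus_lipschitz_const:
    "\<lbrakk>continuous_on UNIV w; \<And>x. w (x + 1) = w x; \<bar>t - y\<bar> \<le> 1\<rbrakk> \<Longrightarrow>
      Tminus S c w t - Tminus S c w y \<le> lipschitz_const c * \<bar>t - y\<bar>"
proof -
  have *: "lipschitz_const c \<ge> 0 \<and> (\<forall>w. continuous_on UNIV w \<longrightarrow> (\<forall>x. w (x + 1) = w x) \<longrightarrow>
     (\<forall>y t. \<bar>t - y\<bar> \<le> 1 \<longrightarrow> Tminus S c w t - Tminus S c w y \<le> lipschitz_const c * \<bar>t - y\<bar>))"
    unfolding lipschitz_const_def using Tminus_lipschitz[of c] by (rule someI_ex)
  then show "lipschitz_const c \<ge> 0" by blast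
  show "\<lbrakk>continuous_on UNIV w; \<And>x. w (x + 1) = w x; \<bar>t - y\<bar> \<le> 1\<rbrakk> \<Longrightarrow>
      Tminus S c w t - Tminus S c w y \<le> lipschitz_const c * \<bar>t - y\<bar>"
    using * by blast
qed

lemma lip_periodicD:
  assumes "lip_periodic c w"
  shows "w (x + 1) = w x" "\<bar>x - y\<bar> \<le> 1 \<Longrightarrow> w x - w y \<le> lipschitz_const c * \<bar>x - y\<bar>"
  using assms by (auto simp: lip_periodic_def)

lemma lip_periodic_continuous:
  assumes "lip_periodic c w"
  shows "continuous_on UNIV w"
proof -
  let ?L = "lipschitz_const c"
  have "isCont w y" for y
  proof -
    have "((\<lambda>x. w x - w y) \<longlongrightarrow> 0) (at y)"
    proof (rule Lim_null_comparison)
      have "norm (w x - w y) \<le> ?L * \<bar>x - y\<bar>" if "dist x y < 1" for x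
        using lip_periodicD(2)[OF assms, of x y] lip_periodicD(2)[OF assms, of y x] that
          abs_minus_commute[of x y] by (simp only: dist_real_def real_norm_def) linarith
      then show "\<forall>\<^sub>F x in at y. norm (w x - w y) \<le> ?L * \<bar>x - y\<bar>"
        unfolding eventually_at by (intro exI[of _ 1]) auto
      show "((\<lambda>x. ?L * \<bar>x - y\<bar>) \<longlongrightarrow> 0) (at y)" by (auto intro!: tendsto_eq_intros)
    qed
    then show ?thesis unfolding isCont_def using LIM_zero_iff by blast
  qed
  then show ?thesis by (simp add: continuous_on_eq_continuous_at)
qed

lemma lip_periodic_oscillation:
  assumes "lip_periodic c w"
  shows "w x - w y \<le> lipschitz_const c"
proof -
  define y' where "y' = y + of_int \<lfloor>x - y\<rfloor>"
  have y': "\<bar>x - y'\<bar> \<le> 1" unfolding y'_def by linarith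
  have "w x - w y = w x - w y'"
    unfolding y'_def using periodic_int[of w y] lip_periodicD(1)[OF assms] by simp
  also have "\<dots> \<le> lipschitz_const c * \<bar>x - y'\<bar>" using lip_periodicD(2)[OF assms y'] .
  also have "\<dots> \<le> lipschitz_const c * 1"
    using y' lipschitz_const_nonneg by (intro mult_left_mono)
  finally show ?thesis by simp
qed

lemma lip_periodic_Tminus:
  assumes "lip_periodic c w"
  shows "lip_periodic c (Tminus S c w)"
  using Tminus_periodic Tminus_lipschitz_const lip_periodic_continuous[OF assms]
    lip_periodicD(1)[OF assms]
  by (simp add: lip_periodic_def)

lemma lip_periodic_Tminus_mono:
  assumes "lip_periodic c w" "lip_periodic c w'" "\<And>x. w x \<le> w' x + k"
  shows "Tminus S c w y \<le> Tminus S c w' y + k"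
  using Tminus_mono[of w w'] assms lip_periodic_continuous lip_periodicD(1) by metis

definition iterate :: "real \<Rightarrow> nat \<Rightarrow> real \<Rightarrow> real" where
  "iterate c n = (Tminus S c ^^ n) (\<lambda>_. 0)"

lemma iterate_Suc: "iterate c (Suc n) = Tminus S c (iterate c n)"
  by (simp add: iterate_def)

lemma lip_periodic_iterate: "lip_periodic c (iterate c n)"
proof (induction n)
  case 0
  then show ?case using lipschitz_const_nonneg by (simp add: iterate_def lip_periodic_def)
next
  case (Suc n)
  then show ?case unfolding iterate_Suc by (rule lip_periodic_Tminus)
qed

lemma iterate_mono:
  assumes "\<And>x. iterate c m x \<le> iterate c m' x + k"
  shows "iterate c (m + n) x \<le> iterate c (m' + n) x + k"
proof (induction n arbitrary: x)
  case (Suc n)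
  show ?case using lip_periodic_Tminus_mono[OF lip_periodic_iterate lip_periodic_iterate Suc.IH]
    by (simp add: iterate_Suc)
qed (use assms in simp)

text \<open>The \<open>m\<close>-th iterate differs from the constant \<open>iterate c m 0\<close> by at most its oscillation, and
  \<open>T\<^sup>-\<close> is monotone and commutes with the addition of constants.\<close>

lemma iterate_quasi_additive:
  "\<bar>iterate c (m + n) 0 - iterate c m 0 - iterate c n 0\<bar> \<le> lipschitz_const c"
proof -
  have "iterate c (m + n) 0 \<le> iterate c (0 + n) 0 + (iterate c m 0 + lipschitz_const c)"
  proof (rule iterate_mono)
    show "iterate c m x \<le> iterate c 0 x + (iterate c m 0 + lipschitz_const c)" for x
      using lip_periodic_oscillation[OF lip_periodic_iterate, of c m x 0] by (simp add: iterate_def)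
  qed
  moreover have "iterate c (0 + n) 0 \<le> iterate c (m + n) 0 + (lipschitz_const c - iterate c m 0)"
  proof (rule iterate_mono)
    show "iterate c 0 x \<le> iterate c m x + (lipschitz_const c - iterate c m 0)" for x
      using lip_periodic_oscillation[OF lip_periodic_iterate, of c m 0 x] by (simp add: iterate_def)
  qed
  ultimately show ?thesis by (simp add: abs_le_iff)
qed

text \<open>By the quasi-additivity of the iterates of \<open>T\<^sup>-\<close> on \<open>0\<close>, subtracting \<open>n s\<close> from the \<open>n\<close>-th
  one leaves a bounded sequence \<open>U\<close>. Its lower limit is the solution: \<open>T\<^sup>-\<close> commutes with the
  infimum over the tail from \<open>n\<close>, and with the increasing limit in \<open>n\<close> because the sources stay in
  a compact interval and all functions are equi-Lipschitz.\<close>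

lemma weak_KAM_exists: "\<exists>s v. weak_KAM_with_constant S c s v"
proof -
  let ?L = "lipschitz_const c"
  let ?K = "step_bound \<bar>c\<bar>"
  obtain s where s: "\<And>n. \<bar>iterate c n 0 - real n * s\<bar> \<le> ?L"
    using quasi_additive_linear[of "\<lambda>n. iterate c n 0"] iterate_quasi_additive by blast
  define U where "U n x = iterate c n x - real n * s" for n x
  have U_bound: "\<bar>U n x\<bar> \<le> 2 * ?L" for n x
    using s[of n] lip_periodic_oscillation[OF lip_periodic_iterate, of c n x 0]
      lip_periodic_oscillation[OF lip_periodic_iterate, of c n 0 x]
    unfolding U_def by (simp add: abs_le_iff)
  have U_step: "U (Suc n) y \<le> U n x + S_coh S c (x, y) - s" for n x y
    using Tminus_le[OF lip_periodic_continuous[OF lip_periodic_iterate]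
        lip_periodicD(1)[OF lip_periodic_iterate], of c c n y x]
    by (simp add: U_def iterate_Suc algebra_simps)
  have U_per: "U n (x + 1) = U n x" for n x
    using lip_periodicD(1)[OF lip_periodic_iterate, of c n x] by (simp add: U_def)
  have U_lip: "U n x - U n y \<le> ?L * \<bar>x - y\<bar>" if "\<bar>x - y\<bar> \<le> 1" for n x y
    using lip_periodicD(2)[OF lip_periodic_iterate that, of c n] by (simp add: U_def)
  define W where "W n x = (INF m\<in>{n..}. U m x)" for n x
  have U_bdd: "bdd_below ((\<lambda>m. U m x) ` A)" for x A
  proof (rule bdd_belowI2)
    show "- (2 * ?L) \<le> U m x" for m using U_bound[of m x] by linarith
  qed
  have W_le: "W n x \<le> U m x" if "n \<le> m" for n m x
    unfolding W_def using that by (intro cINF_lower U_bdd) simp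
  have W_ge: "a \<le> W n x" if "\<And>m. n \<le> m \<Longrightarrow> a \<le> U m x" for a n x
    unfolding W_def using that by (intro cINF_greatest) auto
  have W_lip: "W n x - W n y \<le> ?L * \<bar>x - y\<bar>" if "\<bar>x - y\<bar> \<le> 1" for n x y
  proof -
    have "W n x - ?L * \<bar>x - y\<bar> \<le> W n y"
      using W_le[of n _ x] U_lip[OF that] by (intro W_ge) (smt (verit))
    then show ?thesis by simp
  qed
  have W_lp: "lip_periodic c (W n)" for n
    unfolding lip_periodic_def using W_lip by (simp add: W_def U_per)
  have W_bound: "\<bar>W n x\<bar> \<le> 2 * ?L" for n x
  proof -
    have "W n x \<le> 2 * ?L" using W_le[of n n x] U_bound[of n x] by (simp add: abs_le_iff)
    moreover have "- (2 * ?L) \<le> W n x"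
      using U_bound by (intro W_ge) (auto simp: abs_le_iff minus_le_iff)
    ultimately show ?thesis by (simp add: abs_le_iff)
  qed
  have W_mono: "incseq (\<lambda>n. W n x)" for x
    by (intro incseq_SucI W_ge W_le) simp
  have W_step_ge: "W (Suc n) y \<le> W n x + S_coh S c (x, y) - s" for n x y
  proof -
    have "W (Suc n) y - S_coh S c (x, y) + s \<le> W n x"
    proof (rule W_ge)
      fix m assume "n \<le> m"
      then show "W (Suc n) y - S_coh S c (x, y) + s \<le> U m x"
        using W_le[of "Suc n" "Suc m" y] U_step[of m y x] by simp
    qed
    then show ?thesis by simp
  qed
  have W_step_le: "Tminus S c (W n) y \<le> W (Suc n) y + s" for n y
  proof -
    have "Tminus S c (W n) y - s \<le> W (Suc n) y"
    proof (rule W_ge)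
      fix m' assume "Suc n \<le> m'"
      then obtain m where m: "m' = Suc m" "n \<le> m" by (metis Suc_le_D Suc_le_mono)
      have "Tminus S c (W n) y \<le> Tminus S c (iterate c m) y + (- real m * s)"
        using W_le[OF m(2)] by (intro lip_periodic_Tminus_mono W_lp lip_periodic_iterate)
          (simp add: U_def)
      then show "Tminus S c (W n) y - s \<le> U m' y"
        by (simp add: m(1) U_def iterate_Suc algebra_simps)
    qed
    then show ?thesis by simp
  qed
  define v where "v x = (SUP n. W n x)" for x
  have W_bdd: "bdd_above (range (\<lambda>n. W n x))" for x
    using W_bound by (intro bdd_aboveI[of _ "2 * ?L"]) (auto simp: abs_le_iff)
  have W_lim: "(\<lambda>n. W n x) \<longlonglongrightarrow> v x" for x
    unfolding v_def by (rule LIMSEQ_incseq_SUP[OF W_bdd W_mono])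
  have W_le_v: "W n x \<le> v x" for n x
    unfolding v_def by (rule cSUP_upper[OF _ W_bdd]) simp
  have v_lip: "v x - v y \<le> ?L * \<bar>x - y\<bar>" if "\<bar>x - y\<bar> \<le> 1" for x y
    by (rule LIMSEQ_le_const2[OF tendsto_diff[OF W_lim W_lim]]) (use W_lip[OF that] in blast)
  have v_lp: "lip_periodic c v"
    unfolding lip_periodic_def using v_lip by (simp add: v_def W_def U_per)
  have v_cont: "continuous_on UNIV v" and v_per: "v (x + 1) = v x" for x
    using lip_periodic_continuous[OF v_lp] lip_periodicD(1)[OF v_lp] by auto
  have "v y = Tminus S c v y - s" for y
  proof (rule antisym)
    obtain x where "Tminus S c v y = v x + S_coh S c (x, y)"
      using Tminus_attained[OF v_cont v_per] by blast
    moreover have "v y \<le> v x + S_coh S c (x, y) - s"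
    proof (rule LIMSEQ_le_const2[OF LIMSEQ_Suc[OF W_lim]])
      show "\<exists>N. \<forall>n\<ge>N. W (Suc n) y \<le> v x + S_coh S c (x, y) - s"
        using W_step_ge[of _ y x] W_le_v[of _ x] by (intro exI[of _ 0]) (smt (verit))
    qed
    ultimately show "v y \<le> Tminus S c v y - s" by simp
  next
    have "\<exists>x. \<bar>y - x\<bar> \<le> ?K \<and> Tminus S c (W n) y = W n x + S_coh S c (x, y)" for n
      using Tminus_attained[OF lip_periodic_continuous[OF W_lp] lip_periodicD(1)[OF W_lp]] by blast
    then obtain X where X: "\<And>n. \<bar>y - X n\<bar> \<le> ?K"
      "\<And>n. Tminus S c (W n) y = W n (X n) + S_coh S c (X n, y)" by metis
    have "\<forall>n. X n \<in> {y - ?K..y + ?K}" using X(1) by (auto simp: abs_le_iff algebra_simps)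
    then obtain x r where r: "strict_mono r" and x: "(X \<circ> r) \<longlonglongrightarrow> x"
      using compact_Icc[of "y - ?K" "y + ?K"] unfolding compact_def by metis
    have Xr: "(\<lambda>n. X (r n)) \<longlonglongrightarrow> x" using x by (simp add: o_def)
    have lhs: "(\<lambda>n. W (r n) x) \<longlonglongrightarrow> v x"
      using LIMSEQ_subseq_LIMSEQ[OF W_lim r] by (simp add: o_def)
    have S_lim: "(\<lambda>n. S_coh S c (X (r n), y)) \<longlonglongrightarrow> S_coh S c (x, y)"
      using S_coh_continuous[of c] by (intro isCont_tendsto_compose[of _ "S_coh S c"]
          tendsto_Pair Xr tendsto_const) (simp_all add: continuous_on_eq_continuous_at)
    have "(\<lambda>n. v y + s - S_coh S c (X (r n), y) + ?L * \<bar>x - X (r n)\<bar>)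
        \<longlonglongrightarrow> v y + s - S_coh S c (x, y) + ?L * \<bar>x - x\<bar>"
      by (intro tendsto_intros S_lim Xr)
    then have rhs: "(\<lambda>n. v y + s - S_coh S c (X (r n), y) + ?L * \<bar>x - X (r n)\<bar>)
        \<longlonglongrightarrow> v y + s - S_coh S c (x, y)" by simp
    have "\<forall>\<^sub>F n in sequentially. dist (X (r n)) x < 1" using tendstoD[OF Xr] by simp
    then have "\<forall>\<^sub>F n in sequentially.
        W (r n) x \<le> v y + s - S_coh S c (X (r n), y) + ?L * \<bar>x - X (r n)\<bar>"
    proof eventually_elim
      case (elim n)
      have "W (r n) x - W (r n) (X (r n)) \<le> ?L * \<bar>x - X (r n)\<bar>"
        using elim by (intro W_lip) (simp add: dist_real_def abs_minus_commute)
      moreover have "W (r n) (X (r n)) + S_coh S c (X (r n), y) \<le> v y + s"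
        using X(2)[of "r n"] W_step_le[of "r n" y] W_le_v[of "Suc (r n)" y] by simp
      ultimately show ?case by simp
    qed
    then have "v x \<le> v y + s - S_coh S c (x, y)"
      using tendsto_le[OF _ rhs lhs] by simp
    then show "Tminus S c v y - s \<le> v y"
      using Tminus_le[OF v_cont v_per, of c y x] by simp
  qed
  then have "weak_KAM_with_constant S c s v"
    unfolding weak_KAM_with_constant_def using v_cont v_per by blast
  then show ?thesis by blast
qed

end

section \<open>Rational derivative of Mather's function\<close>

context twist_generating
begin

lemma weak_KAM_S_bar: "\<exists>v. weak_KAM_with_constant S c (S_bar S c) v"
  using weak_KAM_exists[of c] S_bar_eq by blast

end

lemma (in weak_KAM) mather_alpha_derivative:
  assumes q: "q > 0" and per: "(forward ^^ q) x = x + of_int p"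
  shows "(mather_alpha S has_real_derivative of_int p / real q) (at c)"
proof -
  let ?\<rho> = "of_int p / real q"
  have "\<exists>\<delta>>0. \<forall>c'. c' \<noteq> c \<and> norm (c' - c) < \<delta> \<longrightarrow>
      norm ((mather_alpha S c' - mather_alpha S c) / (c' - c) - ?\<rho>) < \<epsilon>" if eps: "\<epsilon> > 0" for \<epsilon>
  proof -
    have "\<epsilon> / 2 > 0" using eps by simp
    then obtain C where C: "C \<ge> 0" and est: "\<And>c' s' u'. \<bar>c' - c\<bar> \<le> 1 \<Longrightarrow>
        weak_KAM_with_constant S c' s' u' \<Longrightarrow>
        \<bar>(s - s') - ?\<rho> * (c' - c)\<bar> \<le> \<bar>c' - c\<bar> * (\<epsilon> / 2 + C * \<bar>c' - c\<bar>)"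
      using constant_expansion[OF q per] by metis
    \<comment> \<open>Makes \<open>C * \<bar>c' - c\<bar>\<close> smaller than \<open>\<epsilon> / 2\<close>; the summand 1 allows \<open>C = 0\<close>.\<close>
    define \<delta> where "\<delta> = min 1 (\<epsilon> / (2 * (C + 1)))"
    have "norm ((mather_alpha S c' - mather_alpha S c) / (c' - c) - ?\<rho>) < \<epsilon>"
      if c': "c' \<noteq> c" "norm (c' - c) < \<delta>" for c'
    proof -
      have h: "\<bar>c' - c\<bar> < 1" "\<bar>c' - c\<bar> < \<epsilon> / (2 * (C + 1))" using c'(2) by (auto simp: \<delta>_def)
      obtain v where v: "weak_KAM_with_constant S c' (S_bar S c') v" using weak_KAM_S_bar by blast
      have "(mather_alpha S c' - mather_alpha S c) / (c' - c) - ?\<rho>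
          = ((s - S_bar S c') - ?\<rho> * (c' - c)) / (c' - c)"
        using c'(1) S_bar_eq[OF solution] by (simp add: mather_alpha_def diff_divide_distrib)
      then have "norm ((mather_alpha S c' - mather_alpha S c) / (c' - c) - ?\<rho>)
          = \<bar>(s - S_bar S c') - ?\<rho> * (c' - c)\<bar> / \<bar>c' - c\<bar>"
        by simp
      also have "\<dots> \<le> \<epsilon> / 2 + C * \<bar>c' - c\<bar>"
        using est[OF _ v] h(1) c'(1) by (simp add: pos_divide_le_eq mult.commute)
      also have "C * \<bar>c' - c\<bar> < \<epsilon> / 2"
      proof -
        have "(C + 1) * \<bar>c' - c\<bar> < \<epsilon> / 2" using h(2) C by (simp add: field_simps)
        then show ?thesis by (simp add: distrib_right) (smt (verit) abs_ge_zero)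
      qed
      finally show ?thesis by simp
    qed
    moreover have "\<delta> > 0" using eps C by (simp add: \<delta>_def)
    ultimately show ?thesis by blast
  qed
  then show ?thesis unfolding has_field_derivative_iff LIM_def dist_norm by auto
qed

text \<open>The partial derivative \<open>\<partial>\<^sub>2S\<close> is the value of the Frechet derivative on the second basis vector, hence itself
  differentiable.\<close>

lemma generating_function_twist_generating:
  assumes "generating_function F S"
  shows "\<exists>P e. twist_generating S P e"
proof -
  obtain S' :: "real \<times> real \<Rightarrow> (real \<times> real) \<Rightarrow>\<^sub>L real" where
    S': "\<And>z. (S has_derivative blinfun_apply (S' z)) (at z)" and "C1_map S'"
    using assms unfolding generating_function_def C2_map_def by blast
  then obtain S'' where S'': "\<And>z. (S' has_derivative blinfun_apply (S'' z)) (at z)"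
    unfolding C1_map_def by blast
  obtain e where e: "e > 0" "\<And>z. partial1 (partial2 S) z < - e"
    using assms unfolding generating_function_def by blast
  define P where "P z = S' z (0, 1)" for z
  have deriv2: "((\<lambda>t. S (x, t)) has_real_derivative P (x, y)) (at y)" for x y
  proof -
    have "((\<lambda>t. S (x, t)) has_derivative (\<lambda>h. S' (x, y) (0, h))) (at y)"
      by (rule has_derivative_compose[of "\<lambda>t. (x, t)", OF _ S'])
        (auto intro!: derivative_eq_intros)
    moreover have "(\<lambda>h. S' (x, y) (0, h)) = (*) (P (x, y))"
    proof
      fix h :: real
      have "S' (x, y) (0, h) = S' (x, y) (h *\<^sub>R (0, 1))" by simp
      then show "S' (x, y) (0, h) = P (x, y) * h" unfolding P_def blinfun.scaleR_right by simp
    qed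
    ultimately show ?thesis by (simp add: has_field_derivative_def)
  qed
  have partial2: "partial2 S = P"
    using deriv2 by (auto simp: partial2_def fun_eq_iff DERIV_imp_deriv)
  have diff: "(\<lambda>t. (t, y)) differentiable (at x)" for x y :: real
    by (auto simp: differentiable_def intro!: derivative_eq_intros)
  have P_diff: "P differentiable (at z)" for z
    unfolding P_def[abs_def] differentiable_def
    using bounded_linear.has_derivative[OF blinfun.bounded_linear_left S''] by blast
  have twist: "P (x', y) \<le> P (x, y) - e * (x' - x)" if "x \<le> x'" for x x' y
  proof -
    have "P (x', y) + e * x' \<le> P (x, y) + e * x"
    proof (rule DERIV_nonpos_imp_nonincreasing[OF that])
      fix t
      have "(\<lambda>t. P (t, y)) differentiable (at t)"
        using differentiable_chain_at[OF diff P_diff] by (simp add: o_def)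
      then obtain D where D: "((\<lambda>t. P (t, y)) has_real_derivative D) (at t)"
        by (auto simp: real_differentiable_def)
      then have "D < - e"
        using e(2)[of "(t, y)"] DERIV_imp_deriv[OF D] by (simp add: partial2 partial1_def)
      moreover have "((\<lambda>t. P (t, y) + e * t) has_real_derivative D + e) (at t)"
        by (auto intro!: derivative_eq_intros D)
      ultimately show "\<exists>D. ((\<lambda>t. P (t, y) + e * t) has_real_derivative D) (at t) \<and> D \<le> 0"
        by (intro exI[of _ "D + e"]) auto
    qed
    then show ?thesis by (simp add: algebra_simps)
  qed
  have "twist_generating S P e"
  proof
    show "S (x + 1, y + 1) = S (x, y)" for x y
      using assms unfolding generating_function_def by blast
    show "continuous_on UNIV S"
      using S' by (meson continuous_at_imp_continuous_on has_derivative_continuous)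
    have "S differentiable (at z)" for z
      unfolding differentiable_def using S' by blast
    then show "\<exists>D. ((\<lambda>t. S (t, y)) has_real_derivative D) (at x)" for x y
      using differentiable_chain_at[OF diff, of S x y] by (simp add: o_def real_differentiable_def)
    show "continuous_on UNIV P"
      using P_diff by (simp add: continuous_on_eq_continuous_at differentiable_imp_continuous_within)
  qed (use deriv2 e(1) twist in auto)
  then show ?thesis by blast
qed

theorem corollary1p3:
  fixes f :: "complex \<times> real \<Rightarrow> complex \<times> real"
    and F :: "real \<times> real \<Rightarrow> real \<times> real"
    and S :: "real \<times> real \<Rightarrow> real"
    and c :: real
    and u :: "real \<Rightarrow> real"
  assumes "twist_map f"
    and "is_lift F f"
    and "generating_function F S"
    and "weak_KAM_solution S c u"
  shows "(Sing_mod u \<noteq> {} \<and> finite (Sing_mod u) \<longrightarrow> deriv (mather_alpha S) c \<in> \<rat>) \<and>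
         (deriv (mather_alpha S) c \<notin> \<rat> \<longrightarrow>
            Sing_mod u = {} \<or> (countable (Sing_mod u) \<and> infinite (Sing_mod u)))"
proof -
  obtain P e where "twist_generating S P e"
    using generating_function_twist_generating[OF assms(3)] by blast
  then interpret weak_KAM S P e c "S_bar S c" u
    using assms(4) unfolding weak_KAM_solution_def by (intro weak_KAM.intro weak_KAM_axioms.intro)
  have "deriv (mather_alpha S) c \<in> \<rat>" if sing: "Sing_mod u \<noteq> {}" "finite (Sing_mod u)"
  proof -
    obtain q :: nat and p x where "q > 0" "(forward ^^ q) x = x + of_int p"
      using finite_Sing_periodic[OF sing] .
    then have "deriv (mather_alpha S) c = of_int p / real q"
      using mather_alpha_derivative DERIV_imp_deriv by blast
    then show ?thesis by simp
  qed
  moreover have "countable (Sing_mod u)"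
    unfolding Sing_mod_def using countable_Sing by (rule countable_image)
  ultimately show ?thesis by blast
qed

end
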